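(* Let $k\geq 1$ be a fixed integer. Then almost surely $$\kappa_3\!\left(G\!\left(n,\frac{\log n+(k+1)\log\log n-\log\log\log n}{n}\right)\right)\geq k.$$
   Context: $\log$ is the natural logarithm; $G(n,p)$ is the binomial random graph on $n$ vertices, $n\to\infty$, and "almost surely" means with probability tending to $1$. For $S\subseteq V(G)$, trees $T_1,\dots,T_k$ are internally disjoint trees connecting $S$ if $S\subseteq V(T_i)$, $E(T_i)\cap E(T_j)=\emptyset$ and $V(T_i)\cap V(T_j)=S$ for $i\neq j$; $\kappa(S)$ is the maximum number of such trees and $\kappa_3(G)=\min\{\kappa(S):|S|=3\}$, with $\kappa_3(G)=0$ if $G$ is disconnected. *)

theory Defs
  imports "HOL-Probability.Probability"
begin

definition all_edges :: "nat \<Rightarrow> nat set set" where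
  "all_edges n = {e. e \<subseteq> {0..<n} \<and> card e = 2}"

text \<open>The binomial random graph G(n,p): each of the possible edges is present
  independently with probability p (bernoulli_pmf clamps p to [0,1]).\<close>

definition Gnp :: "nat \<Rightarrow> real \<Rightarrow> nat set set pmf" where
  "Gnp n p = map_pmf (\<lambda>f. {e \<in> all_edges n. f e})
                     (Pi_pmf (all_edges n) False (\<lambda>_. bernoulli_pmf p))"

text \<open>Connectivity of the graph (V,F): any two vertices of V are joined by a walk
  using edges of F (which will always be contained in V).\<close>

definition connected_graph :: "nat set \<Rightarrow> nat set set \<Rightarrow> bool" where
  "connected_graph V F \<longleftrightarrow>
     (\<forall>u\<in>V. \<forall>v\<in>V. (\<lambda>x y. {x, y} \<in> F)\<^sup>*\<^sup>* u v)"

definition is_tree :: "nat set \<Rightarrow> nat set set \<Rightarrow> bool" where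
  "is_tree V F \<longleftrightarrow> finite V \<and> V \<noteq> {} \<and>
     F \<subseteq> {e. e \<subseteq> V \<and> card e = 2} \<and>
     connected_graph V F \<and> (\<forall>e\<in>F. \<not> connected_graph V (F - {e}))"

definition subtree :: "nat \<Rightarrow> nat set set \<Rightarrow> nat set \<Rightarrow> nat set set \<Rightarrow> bool" where
  "subtree n E V F \<longleftrightarrow> is_tree V F \<and> V \<subseteq> {0..<n} \<and> F \<subseteq> E"

definition kappaS :: "nat \<Rightarrow> nat set set \<Rightarrow> nat set \<Rightarrow> nat" where
  "kappaS n E S = Max {m. \<exists>T :: nat \<Rightarrow> nat set \<times> nat set set.
       (\<forall>i<m. subtree n E (fst (T i)) (snd (T i)) \<and> S \<subseteq> fst (T i)) \<and>
       (\<forall>i<m. \<forall>j<m. i \<noteq> j \<longrightarrow>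
           snd (T i) \<inter> snd (T j) = {} \<and> fst (T i) \<inter> fst (T j) = S)}"

definition kappa3 :: "nat \<Rightarrow> nat set set \<Rightarrow> nat" where
  "kappa3 n E = (if \<not> connected_graph {0..<n} E then 0
     else Min {kappaS n E S | S. S \<subseteq> {0..<n} \<and> card S = 3})"

end

theory Submission
  imports Defs "HOL-Real_Asymp.Real_Asymp"
begin

text \<open>
  At this density almost surely every vertex has degree at least k + 1, and the "low" vertices, those
  of degree below ln n / 20, are pairwise at distance at least 3, so that every vertex has at
  most one low neighbour. Moreover small sets are sparse, and any two sets that are not too small
  are joined by an edge. Hence, after deleting the low vertices and any X of at most ln n / 40 further
  vertices, sets expand by a large constant factor M until they have linear size, and any two
  remaining vertices are joined by a path of length at most about 2 ln n / ln M. Since M is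
  arbitrary, all paths that are needed together use fewer than ln n / 40 vertices and can be
  chosen greedily, disjoint from each other.

  Given a 3-set S, pick k disjoint "ports" outside S and outside the low set among the neighbours
  of each vertex of S, group them into k triples with one port per vertex of S, and connect each
  triple by short paths avoiding everything used before. Enough ports exist because low
  vertices have no common neighbours; the only exception is a low vertex of S adjacent
  to both others, and then one of the trees is the path inside S.
\<close>

section \<open>Connected graphs and degrees\<close>

text \<open>At this density exp (-np) = ln ln n / (n (ln n)^(k+1)), so the expected number of
  vertices of degree at most k is at most of order ln ln n / ln n. Degree k + 1 rather than k is
  wanted because a low vertex of S may lose an edge to another vertex of S and must still keep k
  ports. All other estimates use only ln n <= np <= 2 ln n.

  The obstacle is expansion for all sizes from 1 to n / (M + 3), as no single union bound covers
  this range. Up to size s it comes from sparsity, by counting edges; above s it comes from edges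
  between large sets. The choice of s near n / (ln n)^4 suits both: sparsity wants M s <= n / (ln
  n)^3, and for |A| = a the choice of the sets costs exp (O(a ln ln n)) against a gain of exp (-c a
  ln n) from missing edges.

  The bound ln n / 20 on low degrees is small enough that two given vertices are both low with
  probability at most about n^(-1.3), while only about n (ln n)^2 adjacent pairs and paths of length
  two are expected. All randomness is confined to four events; the rest is deterministic.\<close>

lemma connected_graph_mono:
  assumes "connected_graph V F" "F \<subseteq> F'"
  shows "connected_graph V F'"
proof -
  have "(\<lambda>x y. {x, y} \<in> F) \<le> (\<lambda>x y. {x, y} \<in> F')" using assms(2) by auto
  from rtranclp_mono[OF this] show ?thesis using assms(1) unfolding connected_graph_def by blast
qed

lemma connected_graph_Un:
  assumes "connected_graph V1 F1" "connected_graph V2 F2" "x \<in> V1" "x \<in> V2"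
  shows "connected_graph (V1 \<union> V2) (F1 \<union> F2)"
proof -
  let ?r = "\<lambda>x y. {x, y} \<in> F1 \<union> F2"
  have 1: "?r\<^sup>*\<^sup>* a b" if "a \<in> V1" "b \<in> V1" for a b
    using connected_graph_mono[OF assms(1), of "F1 \<union> F2"] that
    by (auto simp: connected_graph_def)
  have 2: "?r\<^sup>*\<^sup>* a b" if "a \<in> V2" "b \<in> V2" for a b
    using connected_graph_mono[OF assms(2), of "F1 \<union> F2"] that
    by (auto simp: connected_graph_def)
  have "?r\<^sup>*\<^sup>* a x \<and> ?r\<^sup>*\<^sup>* x a" if "a \<in> V1 \<union> V2" for a
    using that 1 2 assms(3,4) by blast
  then show ?thesis
    unfolding connected_graph_def by (meson rtranclp_trans)
qed

lemma connected_graph_edge: "connected_graph {x, y} {{x, y}}"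
  by (auto simp: connected_graph_def insert_commute)

lemma connected_graph_insert:
  assumes "connected_graph V F" "x \<in> V" "{x, y} \<in> F'" "F \<subseteq> F'"
  shows "connected_graph (insert y V) F'"
  using connected_graph_mono[OF connected_graph_Un[OF assms(1) connected_graph_edge[of x y] assms(2)], of F'] assms
  by (simp add: insert_absorb)

text \<open>Each vertex of \<open>T\<close> is tied directly to \<open>W\<close>. This hangs the
  three vertices of S on a connector and, with \<open>W\<close> a single vertex, shows that a star
  is connected.\<close>

lemma connected_graph_attach:
  assumes "connected_graph W F" "F \<subseteq> F'" "finite T"
    "\<And>x. x \<in> T \<Longrightarrow> \<exists>z\<in>W. {z, x} \<in> F'"
  shows "connected_graph (T \<union> W) F'"
  using assms(3,4)
proof (induction T)
  case empty
  then show ?case using assms connected_graph_mono by auto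
next
  case (insert x T)
  then obtain z where "z \<in> W" "{z, x} \<in> F'" by blast
  then show ?case
    using connected_graph_insert[of "T \<union> W" F' z x F'] insert by auto
qed

text \<open>\<open>is_tree\<close> means minimally connected, so a connected edge set of least size
  works: an edge whose deletion keeps it connected would yield a smaller one.\<close>

lemma spanning_tree_exists:
  assumes "finite V" "V \<noteq> {}" "finite F0" "F0 \<subseteq> {e. e \<subseteq> V \<and> card e = 2}" "connected_graph V F0"
  obtains F where "F \<subseteq> F0" "is_tree V F"
proof -
  have "\<exists>F. (F \<subseteq> F0 \<and> connected_graph V F) \<and>
      (\<forall>G. G \<subseteq> F0 \<and> connected_graph V G \<longrightarrow> card F \<le> card G)"
    using assms(5) by (intro ex_has_least_nat[of _ F0]) auto
  then obtain F where F: "F \<subseteq> F0" "connected_graph V F"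
    and min: "\<And>G. G \<subseteq> F0 \<Longrightarrow> connected_graph V G \<Longrightarrow> card F \<le> card G" by blast
  have "\<not> connected_graph V (F - {e})" if "e \<in> F" for e
  proof
    assume "connected_graph V (F - {e})"
    then have "card F \<le> card (F - {e})" using F(1) by (intro min) auto
    moreover have "card (F - {e}) < card F"
      using that F(1) assms(3) finite_subset by (intro card_Diff1_less) auto
    ultimately show False by simp
  qed
  then show thesis using that F assms(1,2,4) by (auto simp: is_tree_def)
qed

section \<open>Neighbourhoods and degree sums\<close>

definition nbrs :: "nat set set \<Rightarrow> nat \<Rightarrow> nat set" where
  "nbrs E x = {y. {x, y} \<in> E}"

definition induced :: "nat set set \<Rightarrow> nat set \<Rightarrow> nat set set" where
  "induced E A = {e \<in> E. e \<subseteq> A}"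

lemma finite_all_edges [simp]: "finite (all_edges n)"
  unfolding all_edges_def by (rule finite_subset[of _ "Pow {0..<n}"]) auto

lemma nbrs_sym: "y \<in> nbrs E x \<longleftrightarrow> x \<in> nbrs E y"
  by (simp add: nbrs_def insert_commute)

lemma nbrs_all_edges:
  assumes "E \<subseteq> all_edges n" "y \<in> nbrs E x"
  shows "y < n" "x < n" "x \<noteq> y"
  using assms by (auto simp: nbrs_def all_edges_def)

lemma nbrs_subset:
  assumes "E \<subseteq> all_edges n"
  shows "nbrs E x \<subseteq> {0..<n} - {x}"
  using nbrs_all_edges[OF assms] by force

lemma finite_nbrs: "E \<subseteq> all_edges n \<Longrightarrow> finite (nbrs E x)"
  by (rule finite_subset[OF nbrs_subset]) auto

text \<open>Double counting of incidences between \<open>A\<close> and the edges inside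
  \<open>B\<close>: an edge has two ends, so it is counted at most twice.\<close>

lemma sum_degrees_le:
  assumes "E \<subseteq> all_edges n" "A \<subseteq> {0..<n}"
    "\<And>a. a \<in> A \<Longrightarrow> d \<le> card (nbrs E a \<inter> B)" "A \<subseteq> B"
  shows "d * card A \<le> 2 * card (induced E B)"
proof -
  let ?F = "induced E B"
  have fF: "finite ?F" unfolding induced_def using assms(1) finite_subset[OF _ finite_all_edges] by auto
  have fA: "finite A" using assms(2) finite_subset by blast
  have deg: "d \<le> card {e\<in>?F. a \<in> e}" if "a \<in> A" for a
  proof -
    have "card (nbrs E a \<inter> B) = card ((\<lambda>y. {a, y}) ` (nbrs E a \<inter> B))"
      by (rule card_image[symmetric]) (auto simp: inj_on_def doubleton_eq_iff)
    also have "\<dots> \<le> card {e\<in>?F. a \<in> e}"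
      using fF that assms(4) by (intro card_mono finite_subset[OF _ fF]) (auto simp: induced_def nbrs_def)
    finally show ?thesis using assms(3)[OF that] by simp
  qed
  have e2: "card {a\<in>A. a \<in> e} \<le> 2" if "e \<in> ?F" for e
  proof -
    have e: "card e = 2" using that assms(1) by (auto simp: induced_def all_edges_def)
    then have "finite e" by (metis card.infinite zero_neq_numeral)
    then have "card {a\<in>A. a \<in> e} \<le> card e" by (intro card_mono) auto
    with e show ?thesis by simp
  qed
  have "d * card A \<le> (\<Sum>a\<in>A. card {e\<in>?F. a \<in> e})"
    using sum_mono[of A "\<lambda>_. d", OF deg] by (simp add: mult.commute)
  also have "\<dots> = (\<Sum>e\<in>?F. card {a\<in>A. a \<in> e})"
    using fA fF by (rule sum_multicount_gen) simp
  also have "\<dots> \<le> 2 * card ?F"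
    using sum_mono[of ?F _ "\<lambda>_. 2", OF e2] by (simp add: mult.commute)
  finally show ?thesis .
qed

section \<open>Expansion and short connections\<close>

text \<open>In \<open>joined\<close>, the conditions on B say that few vertices lie outside A and B, relative to A, so
  that the property gives expansion for medium sets A; for |A| and |B| at least n / (M + 3) the
  third one is void. M is the expansion factor and I the radius at which neighbourhoods
  have become linearly large.\<close>

locale good_graph =
  fixes n k M s t I :: nat and E :: "nat set set"
  assumes edges: "E \<subseteq> all_edges n"
    and min_degree: "x < n \<Longrightarrow> k + 1 \<le> card (nbrs E x)"
    and low_apart: "\<lbrakk>x < n; y < n; x \<noteq> y; card (nbrs E x) < 2 * t; card (nbrs E y) < 2 * t\<rbrakk>
      \<Longrightarrow> {x, y} \<notin> E \<and> nbrs E x \<inter> nbrs E y = {}"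
    and sparse: "\<lbrakk>A \<subseteq> {0..<n}; A \<noteq> {}; card A \<le> M * s\<rbrakk> \<Longrightarrow> card (induced E A) < 2 * card A"
    and joined: "\<lbrakk>A \<subseteq> {0..<n}; B \<subseteq> {0..<n}; A \<inter> B = {}; s \<le> card A; n \<le> (M + 3) * card B;
      n \<le> card B + (M + 2) * card A\<rbrakk> \<Longrightarrow> \<exists>a\<in>A. \<exists>b\<in>B. {a, b} \<in> E"
    and k: "1 \<le> k" and n: "3 \<le> n" and M: "1 < M" and MI: "n < M ^ I" and Mt: "4 * M + 1 \<le> t"
    and ts: "t \<le> s" and Ms: "(M + 3) * s \<le> n" and kt: "3 + 3 * k + 3 * k * (2 * I + 2) \<le> t"
begin

abbreviation "N \<equiv> nbrs E"

definition low :: "nat set" where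
  "low = {x. x < n \<and> card (N x) < 2 * t}"

lemmas N_finite [simp] = finite_nbrs[OF edges]

lemma low_not_adjacent: "\<lbrakk>x \<in> low; y \<in> low\<rbrakk> \<Longrightarrow> y \<notin> N x"
  using low_apart[of x y] nbrs_all_edges[OF edges, of y x] by (auto simp: low_def nbrs_def)

lemma low_nbrs_disjoint: "\<lbrakk>x \<in> low; y \<in> low; x \<noteq> y\<rbrakk> \<Longrightarrow> N x \<inter> N y = {}"
  using low_apart[of x y] by (auto simp: low_def)

text \<open>Two distinct low neighbours of x would have x as a common neighbour.\<close>

lemma card_low_nbrs: "card (N x \<inter> low) \<le> 1"
proof -
  have "a = b" if "a \<in> N x \<inter> low" "b \<in> N x \<inter> low" for a b
    using low_nbrs_disjoint[of a b] that nbrs_sym by blast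
  then have "\<exists>a. N x \<inter> low \<subseteq> {a}" by blast
  then obtain a where "N x \<inter> low \<subseteq> {a}" ..
  then show ?thesis using card_mono[of "{a}"] by fastforce
qed

section \<open>Balls in the graph without the low vertices and X\<close>

context
  fixes X R :: "nat set"
  assumes X: "finite X" "card X \<le> t" and R: "R = {0..<n} - low - X"
begin

definition nbhd :: "nat set \<Rightarrow> nat set" where
  "nbhd A = A \<union> (\<Union>a\<in>A. N a \<inter> R)"

text \<open>This is why low means below 2t while X has at most t elements: a vertex of R loses at
  most one neighbour to \<open>low\<close> and at most t to X, so at least t - 1 remain, and
  \<open>Mt\<close> makes this at least 4M.\<close>

lemma degree_R:
  assumes "x \<in> R"
  shows "4 * M \<le> card (N x \<inter> R)"
proof -
  have "N x \<subseteq> (N x \<inter> R) \<union> (N x \<inter> low) \<union> X"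
    using nbrs_subset[OF edges, of x] by (auto simp: R)
  then have "card (N x) \<le> card ((N x \<inter> R) \<union> (N x \<inter> low) \<union> X)"
    using X by (intro card_mono) auto
  also have "\<dots> \<le> card (N x \<inter> R) + card (N x \<inter> low) + card X"
    by (meson card_Un_le add_le_mono1 le_trans)
  finally have "card (N x) \<le> card (N x \<inter> R) + 1 + t"
    using card_low_nbrs[of x] X by simp
  moreover have "2 * t \<le> card (N x)" using assms by (auto simp: R low_def)
  ultimately show ?thesis using Mt by simp
qed

lemma nbhd_subset: "A \<subseteq> R \<Longrightarrow> nbhd A \<subseteq> R"
  by (auto simp: nbhd_def)

lemma finite_R: "finite R" "R \<subseteq> {0..<n}"
  by (auto simp: R)

text \<open>If the factor M were missed by a set of size at most s, \<open>nbhd A\<close> would be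
  too dense: degrees 4M force at least 2M |A| edges onto fewer than M |A| vertices, against
  \<open>sparse\<close>. A larger A would have no edge to the large complement of its full
  neighbourhood, against \<open>joined\<close>.\<close>

lemma expansion:
  assumes A: "A \<subseteq> R" "A \<noteq> {}" and small: "(M + 3) * card A < n"
  shows "M * card A \<le> card (nbhd A)"
proof (rule ccontr)
  assume "\<not> ?thesis"
  then have lt: "card (nbhd A) < M * card A" by simp
  have fA: "finite A" using A(1) finite_R finite_subset by blast
  have fN: "finite (nbhd A)" using nbhd_subset[OF A(1)] finite_R finite_subset by blast
  have AV: "A \<subseteq> {0..<n}" "nbhd A \<subseteq> {0..<n}"
    using A(1) finite_R nbhd_subset[OF A(1)] by auto
  show False
  proof (cases "card A \<le> s")
    case True
    have "4 * M * card A \<le> 2 * card (induced E (nbhd A))"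
    proof (rule sum_degrees_le[OF edges AV(1)])
      fix a assume a: "a \<in> A"
      have "4 * M \<le> card (N a \<inter> R)" using a A(1) degree_R by blast
      also have "\<dots> \<le> card (N a \<inter> nbhd A)"
        using a by (intro card_mono) (auto simp: nbhd_def)
      finally show "4 * M \<le> card (N a \<inter> nbhd A)" .
    qed (auto simp: nbhd_def)
    moreover have "card (induced E (nbhd A)) < 2 * card (nbhd A)"
    proof (rule sparse[OF AV(2)])
      show "nbhd A \<noteq> {}" using A(2) by (auto simp: nbhd_def)
      have "M * card A \<le> M * s" using True by simp
      with lt show "card (nbhd A) \<le> M * s" by linarith
    qed
    ultimately show False using lt by simp
  next
    case False
    \<comment> \<open>\<open>joined\<close> concerns all vertices, so this neighbourhood is taken in
      the whole graph. Beyond \<open>nbhd A\<close> it has at most one low vertex per element of A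
      and at most |X| <= t <= s < |A| vertices of X; hence the M + 2 below.\<close>
    define Y where "Y = A \<union> (\<Union>a\<in>A. N a)"
    define B where "B = {0..<n} - Y"
    have "y \<in> R \<union> low \<union> X" if "y < n" for y using that by (auto simp: R)
    then have "Y \<subseteq> nbhd A \<union> (\<Union>a\<in>A. N a \<inter> low) \<union> X"
      using nbrs_all_edges(1)[OF edges] unfolding Y_def nbhd_def by blast
    then have "card Y \<le> card (nbhd A \<union> (\<Union>a\<in>A. N a \<inter> low) \<union> X)"
      using fN fA X by (intro card_mono) auto
    also have "\<dots> \<le> card (nbhd A) + card (\<Union>a\<in>A. N a \<inter> low) + card X"
      by (meson card_Un_le add_le_mono1 le_trans)
    finally have "card Y \<le> card (nbhd A) + card (\<Union>a\<in>A. N a \<inter> low) + card X" .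
    moreover have "card (\<Union>a\<in>A. N a \<inter> low) \<le> card A"
      using card_UN_le[OF fA, of "\<lambda>a. N a \<inter> low"] sum_mono[of A "\<lambda>a. card (N a \<inter> low)" "\<lambda>_. 1"]
        card_low_nbrs by simp
    ultimately have Y: "card Y \<le> (M + 2) * card A"
      using lt X ts False by (simp add: algebra_simps)
    have YV: "Y \<subseteq> {0..<n}" using AV(1) nbrs_subset[OF edges] by (fastforce simp: Y_def)
    then have cB: "card B = n - card Y" unfolding B_def
      by (subst card_Diff_subset) (auto intro: finite_subset)
    have 1: "n \<le> card B + (M + 2) * card A" using cB Y by simp
    \<comment> \<open>Multiplying \<open>1\<close> by M + 3 and inserting \<open>small\<close>
      leaves n <= (M + 3) |B|.\<close>
    have "(M + 3) * n \<le> (M + 3) * card B + (M + 2) * ((M + 3) * card A)"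
      using mult_le_mono2[OF 1, of "M + 3"] by (simp add: algebra_simps)
    also have "\<dots> \<le> (M + 3) * card B + (M + 2) * n"
      using small by (intro add_mono mult_le_mono) auto
    finally have 2: "n \<le> (M + 3) * card B" by (simp add: algebra_simps)
    have "\<exists>a\<in>A. \<exists>b\<in>B. {a, b} \<in> E"
    proof (rule joined[OF AV(1) _ _ _ 2 1])
      show "s \<le> card A" using False by simp
    qed (auto simp: B_def Y_def)
    then show False by (auto simp: B_def Y_def nbrs_def)
  qed
qed

text \<open>Despite the name this is the ball of radius i around a in the graph induced on R:
  \<open>nbhd\<close> keeps its argument, so the sets increase with i and a size once reached is
  never lost.\<close>

primrec layer :: "nat \<Rightarrow> nat \<Rightarrow> nat set" where
  "layer a 0 = {a}"
| "layer a (Suc i) = nbhd (layer a i)"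

lemma layer_subset: "a \<in> R \<Longrightarrow> layer a i \<subseteq> R"
  by (induction i) (auto simp: nbhd_subset)

lemma layer_connected:
  assumes "a \<in> R" "x \<in> layer a i"
  shows "\<exists>W \<subseteq> R. a \<in> W \<and> x \<in> W \<and> card W \<le> i + 1 \<and> connected_graph W (induced E W)"
  using assms(2)
proof (induction i arbitrary: x)
  case 0
  then show ?case using assms(1) by (intro exI[of _ "{a}"]) (auto simp: connected_graph_def)
next
  case (Suc i)
  then consider "x \<in> layer a i" | y where "y \<in> layer a i" "x \<in> N y" "x \<in> R"
    by (auto simp: nbhd_def)
  then show ?case
  proof cases
    case 1
    from Suc.IH[OF this] obtain W where "W \<subseteq> R" "a \<in> W" "x \<in> W" "card W \<le> i + 1"
      "connected_graph W (induced E W)" by blast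
    then show ?thesis by (intro exI[of _ W]) simp
  next
    case 2
    then obtain W where W: "W \<subseteq> R" "a \<in> W" "y \<in> W" "card W \<le> i + 1"
      "connected_graph W (induced E W)" using Suc.IH by blast
    have "connected_graph (insert x W) (induced E (insert x W))"
      using W 2 by (intro connected_graph_insert[OF W(5), of y]) (auto simp: induced_def nbrs_def)
    moreover have "card (insert x W) \<le> Suc i + 1"
      using card_insert_le_m1[of "Suc (Suc i)" W x] W(4) by simp
    ultimately show ?thesis using W(1,2) 2(3) by (intro exI[of _ "insert x W"]) simp
  qed
qed

text \<open>Balls grow by the factor M as long as \<open>expansion\<close> applies, and it stops
  applying only at size n / (M + 3). Growth through all I steps is impossible because M ^ I exceeds
  n.\<close>

lemma layer_large:
  assumes "a \<in> R"
  shows "n \<le> (M + 3) * card (layer a I)"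
proof -
  have "M ^ i \<le> card (layer a i) \<or> n \<le> (M + 3) * card (layer a i)" for i
  proof (induction i)
    case (Suc i)
    have sub: "layer a i \<subseteq> R" by (rule layer_subset[OF assms])
    have "finite (layer a (Suc i))" using layer_subset[OF assms] finite_R finite_subset by blast
    then have le: "card (layer a i) \<le> card (layer a (Suc i))"
      by (intro card_mono) (auto simp: nbhd_def)
    show ?case
    proof (cases "n \<le> (M + 3) * card (layer a i)")
      case True
      then show ?thesis using mult_le_mono2[OF le, of "M + 3"] by linarith
    next
      case False
      then have Mi: "M ^ i \<le> card (layer a i)" using Suc.IH by blast
      then have "layer a i \<noteq> {}" using M by force
      then have "M * card (layer a i) \<le> card (layer a (Suc i))"
        using expansion[OF sub] False by simp
      from order_trans[OF mult_le_mono2[OF Mi] this] show ?thesis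
        by (simp only: power_Suc simp_thms)
    qed
  qed auto
  moreover have "card (layer a I) \<le> n"
    using card_mono[of "{0..<n}" "layer a I"] layer_subset[OF assms] finite_R by force
  ultimately show ?thesis using MI by (metis leD le_trans)
qed

text \<open>The balls of radius I around a and b either meet or, being linearly large, are joined by
  an edge. Two connected sets of at most I + 1 vertices each give the bound 2I + 2.\<close>

lemma short_connection:
  assumes a: "a \<in> R" and b: "b \<in> R"
  shows "\<exists>W \<subseteq> R. a \<in> W \<and> b \<in> W \<and> card W \<le> 2 * I + 2 \<and> connected_graph W (induced E W)"
proof -
  have "\<exists>x\<in>layer a I. \<exists>y\<in>layer b I. x = y \<or> {x, y} \<in> E"
  proof (cases "layer a I \<inter> layer b I = {}")
    case True
    have A: "n \<le> (M + 3) * card (layer a I)" and B: "n \<le> (M + 3) * card (layer b I)"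
      by (rule layer_large[OF a], rule layer_large[OF b])
    have "(M + 3) * s \<le> (M + 3) * card (layer a I)" using A Ms by linarith
    then have 1: "s \<le> card (layer a I)" by (subst (asm) mult_le_cancel1) simp
    \<comment> \<open>Both balls have at least n / (M + 3) vertices, and (M + 2) + 1 such shares add
      up to n.\<close>
    have "(M + 3) * n \<le> (M + 3) * (card (layer b I) + (M + 2) * card (layer a I))"
      using mult_le_mono2[OF A, of "M + 2"] B by (simp add: algebra_simps)
    then have 2: "n \<le> card (layer b I) + (M + 2) * card (layer a I)"
      by (subst (asm) mult_le_cancel1) simp
    have "\<exists>x\<in>layer a I. \<exists>y\<in>layer b I. {x, y} \<in> E"
      using subset_trans[OF layer_subset[OF a] finite_R(2)] subset_trans[OF layer_subset[OF b] finite_R(2)]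
      by (intro joined True 1 2 B)
    then show ?thesis by blast
  qed auto
  then obtain x y where xy: "x \<in> layer a I" "y \<in> layer b I" "x = y \<or> {x, y} \<in> E" by blast
  obtain W1 where W1: "W1 \<subseteq> R" "a \<in> W1" "x \<in> W1" "card W1 \<le> I + 1" "connected_graph W1 (induced E W1)"
    using layer_connected[OF a xy(1)] by blast
  obtain W2 where W2: "W2 \<subseteq> R" "b \<in> W2" "y \<in> W2" "card W2 \<le> I + 1" "connected_graph W2 (induced E W2)"
    using layer_connected[OF b xy(2)] by blast
  let ?W = "W1 \<union> W2"
  have sub: "induced E W1 \<subseteq> induced E ?W" "induced E W2 \<subseteq> induced E ?W" by (auto simp: induced_def)
  have "connected_graph (insert y W1) (induced E ?W)"
    using xy(3)
  proof
    assume "x = y"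
    then show ?thesis using connected_graph_mono[OF W1(5) sub(1)] W1(3) by (simp add: insert_absorb)
  next
    assume "{x, y} \<in> E"
    then show ?thesis
      using W1 W2 by (intro connected_graph_insert[OF W1(5) W1(3)] sub) (auto simp: induced_def)
  qed
  from connected_graph_Un[OF this W2(5), of y]
  have "connected_graph ?W (induced E ?W)"
    using W2(3) sub(2) by (simp add: Un_absorb2 insert_absorb)
  moreover have "card ?W \<le> 2 * I + 2" using card_Un_le[of W1 W2] W1(4) W2(4) by simp
  ultimately show ?thesis using W1 W2 by (intro exI[of _ ?W]) auto
qed

end

end

section \<open>Disjoint trees\<close>

text \<open>\<open>L\<close> indexes the scarce sets: they may have only K elements but are
  disjoint, so arbitrary choices are compatible and come first. The indices in \<open>H\<close> are
  then served greedily: each earlier index uses K elements, so K are still left.\<close>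

lemma disjoint_representatives:
  fixes A :: "'a \<Rightarrow> 'b set"
  assumes "finite H" "finite L" "H \<inter> L = {}"
    "\<And>x. x \<in> L \<Longrightarrow> K \<le> card (A x)"
    "\<And>x. x \<in> H \<Longrightarrow> K * card (L \<union> H) \<le> card (A x)"
    "\<And>x y. \<lbrakk>x \<in> L; y \<in> L; x \<noteq> y\<rbrakk> \<Longrightarrow> A x \<inter> A y = {}"
    "\<And>x. x \<in> L \<union> H \<Longrightarrow> finite (A x)"
  shows "\<exists>Z. (\<forall>x\<in>L \<union> H. Z x \<subseteq> A x \<and> card (Z x) = K) \<and>
    (\<forall>x\<in>L \<union> H. \<forall>y\<in>L \<union> H. x \<noteq> y \<longrightarrow> Z x \<inter> Z y = {})"
  using assms(1,3,5,7)
proof (induction H)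
  case empty
  have "\<forall>x\<in>L. \<exists>Z. Z \<subseteq> A x \<and> card Z = K"
    using assms(4) by (meson obtain_subset_with_card_n)
  then obtain Z where "\<forall>x\<in>L. Z x \<subseteq> A x \<and> card (Z x) = K" by metis
  then show ?case using assms(6) by (intro exI[of _ Z]) blast
next
  case (insert h H)
  have "\<exists>Z. (\<forall>x\<in>L \<union> H. Z x \<subseteq> A x \<and> card (Z x) = K) \<and>
    (\<forall>x\<in>L \<union> H. \<forall>y\<in>L \<union> H. x \<noteq> y \<longrightarrow> Z x \<inter> Z y = {})"
  proof (rule insert.IH)
    fix x assume "x \<in> H"
    then have "K * card (L \<union> insert h H) \<le> card (A x)" using insert.prems(2) by blast
    moreover have "card (L \<union> H) \<le> card (L \<union> insert h H)"
      using insert.hyps assms(2) by (intro card_mono) auto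
    ultimately show "K * card (L \<union> H) \<le> card (A x)" by (meson le_trans mult_le_mono2)
  qed (use insert.prems in auto)
  then obtain Z where Z0: "\<forall>x\<in>L \<union> H. Z x \<subseteq> A x \<and> card (Z x) = K"
    and Z1: "\<forall>x\<in>L \<union> H. \<forall>y\<in>L \<union> H. x \<noteq> y \<longrightarrow> Z x \<inter> Z y = {}" by (elim exE conjE)
  have Z: "\<And>x. x \<in> L \<union> H \<Longrightarrow> Z x \<subseteq> A x \<and> card (Z x) = K"
    "\<And>x y. \<lbrakk>x \<in> L \<union> H; y \<in> L \<union> H; x \<noteq> y\<rbrakk> \<Longrightarrow> Z x \<inter> Z y = {}"
    using Z0 Z1 by blast+
  let ?U = "\<Union>x\<in>L \<union> H. Z x"
  have fin: "finite (L \<union> H)" using insert.hyps assms(2) by simp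
  have fU: "finite ?U" using fin Z(1) insert.prems(3) by (auto intro: finite_subset)
  have "card ?U \<le> (\<Sum>x\<in>L \<union> H. card (Z x))" using fin by (rule card_UN_le)
  also have "\<dots> = K * card (L \<union> H)" using Z(1) by simp
  finally have U: "card ?U \<le> K * card (L \<union> H)" .
  have "h \<notin> L \<union> H" using insert by auto
  then have "K * card (L \<union> H) + K \<le> card (A h)"
    using insert.prems(2)[of h] fin by simp
  with U have "K \<le> card (A h - ?U)"
    using diff_card_le_card_Diff[OF fU, of "A h"] by linarith
  then obtain Zh where Zh: "Zh \<subseteq> A h - ?U" "card Zh = K"
    by (meson obtain_subset_with_card_n)
  let ?Z = "Z(h := Zh)"
  have ne: "x \<noteq> h" if "x \<in> L \<union> H" for x using that \<open>h \<notin> L \<union> H\<close> by blast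
  have eq: "L \<union> insert h H = insert h (L \<union> H)" by simp
  have "\<forall>x\<in>L \<union> insert h H. ?Z x \<subseteq> A x \<and> card (?Z x) = K"
    unfolding eq using Z(1) Zh ne by auto
  moreover have "?Z x \<inter> ?Z y = {}"
    if xy: "x \<in> L \<union> insert h H" "y \<in> L \<union> insert h H" "x \<noteq> y" for x y
  proof -
    have sep: "Zh \<inter> Z w = {}" if "w \<in> L \<union> H" for w using Zh(1) that by blast
    consider "x = h" "y \<in> L \<union> H" | "y = h" "x \<in> L \<union> H" | "x \<in> L \<union> H" "y \<in> L \<union> H"
      using xy by blast
    then show ?thesis
    proof cases
      case 1 then show ?thesis using sep[of y] ne by simp
    next
      case 2 then show ?thesis using sep[of x] ne by (simp add: Int_commute)
    next
      case 3 then show ?thesis using Z(2)[OF 3 xy(3)] ne by simp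
    qed
  qed
  ultimately show ?case by (intro exI[of _ ?Z]) blast
qed

text \<open>The condition under \<open>Max\<close> in \<open>kappaS\<close> with the family T
  exposed, so that further properties of T can be carried along.\<close>

definition tree_packing :: "nat \<Rightarrow> nat set set \<Rightarrow> nat set \<Rightarrow> nat \<Rightarrow> (nat \<Rightarrow> nat set \<times> nat set set) \<Rightarrow> bool" where
  "tree_packing n E S m T \<longleftrightarrow>
     (\<forall>i<m. subtree n E (fst (T i)) (snd (T i)) \<and> S \<subseteq> fst (T i)) \<and>
     (\<forall>i<m. \<forall>j<m. i \<noteq> j \<longrightarrow>
        snd (T i) \<inter> snd (T j) = {} \<and> fst (T i) \<inter> fst (T j) = S)"

text \<open>Makes the set under \<open>Max\<close> in \<open>kappaS\<close> finite. Each tree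
  contains an edge, as S has two distinct vertices, and the edge sets are disjoint.\<close>

lemma tree_packing_le:
  assumes T: "tree_packing n E S m T" and "finite E" "2 \<le> card S"
  shows "m \<le> card E"
proof -
  have ne: "snd (T i) \<noteq> {}" if "i < m" for i
  proof
    assume "snd (T i) = {}"
    with T that have "connected_graph (fst (T i)) {}" "S \<subseteq> fst (T i)"
      by (auto simp: tree_packing_def subtree_def is_tree_def)
    moreover obtain a b where ab: "a \<in> S" "b \<in> S" "a \<noteq> b"
      using assms(3) by (metis card_le_Suc0_iff_eq card.infinite not_less_eq_eq numeral_2_eq_2 zero_le)
    ultimately have "(\<lambda>x y. {x, y} \<in> ({} :: nat set set))\<^sup>*\<^sup>* a b"
      unfolding connected_graph_def by blast
    with ab(3) show False by (auto elim: converse_rtranclpE)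
  qed
  have sub: "snd (T i) \<subseteq> E" if "i < m" for i
    using T that by (auto simp: tree_packing_def subtree_def)
  have fin: "finite (snd (T i))" if "i < m" for i
    using sub[OF that] assms(2) finite_subset by blast
  have "m = (\<Sum>i<m. 1)" by simp
  also have "\<dots> \<le> (\<Sum>i<m. card (snd (T i)))"
  proof (rule sum_mono)
    fix i assume "i \<in> {..<m}"
    then show "1 \<le> card (snd (T i))" using ne[of i] fin[of i] card_gt_0_iff[of "snd (T i)"] by simp
  qed
  also have "\<dots> = card (\<Union>i<m. snd (T i))"
    using T fin by (intro card_UN_disjoint[symmetric]) (auto simp: tree_packing_def)
  also have "\<dots> \<le> card E" using sub assms(2) by (intro card_mono) auto
  finally show ?thesis .
qed

lemma kappaS_ge:
  assumes "tree_packing n E S k T" "finite E" "2 \<le> card S"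
  shows "k \<le> kappaS n E S"
proof -
  have "kappaS n E S = Max {m. \<exists>T. tree_packing n E S m T}"
    by (simp add: kappaS_def tree_packing_def)
  moreover have "{m. \<exists>T. tree_packing n E S m T} \<subseteq> {..card E}"
    using tree_packing_le assms(2,3) by blast
  then have "finite {m. \<exists>T. tree_packing n E S m T}" using finite_subset by blast
  ultimately show ?thesis using assms(1) by (auto intro: Max_ge)
qed

lemma induced_mono: "A \<subseteq> B \<Longrightarrow> induced E A \<subseteq> induced E B"
  by (auto simp: induced_def)

section \<open>Packing k trees in a good graph\<close>

context good_graph
begin

lemma finite_E [simp]: "finite E"
  using edges finite_all_edges finite_subset by blast

text \<open>The elements of Q are joined one at a time to an element already included, at a cost of
  at most 2I + 2 vertices each; connections within one set may overlap.\<close>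

lemma connect_set:
  assumes X: "finite X" "card X \<le> t" and R: "R = {0..<n} - low - X"
    and "finite Q" "Q \<noteq> {}" "Q \<subseteq> R"
  shows "\<exists>W \<subseteq> R. Q \<subseteq> W \<and> card W \<le> card Q * (2 * I + 2) \<and> connected_graph W (induced E W)"
  using assms(4-6)
proof (induction Q rule: finite_ne_induct)
  case (singleton x)
  then show ?case by (intro exI[of _ "{x}"]) (auto simp: connected_graph_def)
next
  case (insert x Q)
  then obtain W where W: "W \<subseteq> R" "Q \<subseteq> W" "card W \<le> card Q * (2 * I + 2)"
    "connected_graph W (induced E W)" by auto
  obtain a where a: "a \<in> Q" using insert.hyps by blast
  then have "a \<in> R" "x \<in> R" using insert.prems by auto
  from short_connection[OF X R this] obtain W' where W': "W' \<subseteq> R" "a \<in> W'" "x \<in> W'"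
    "card W' \<le> 2 * I + 2" "connected_graph W' (induced E W')" by blast
  have "connected_graph (W \<union> W') (induced E W \<union> induced E W')"
    by (rule connected_graph_Un[OF W(4) W'(5), of a]) (use a W W' in auto)
  then have "connected_graph (W \<union> W') (induced E (W \<union> W'))"
    by (rule connected_graph_mono) (simp add: induced_mono)
  moreover have "card (W \<union> W') \<le> card (insert x Q) * (2 * I + 2)"
    using card_Un_le[of W W'] W(3) W'(4) insert.hyps by simp
  ultimately show ?case using W W' by (intro exI[of _ "W \<union> W'"]) auto
qed

text \<open>Greedy construction of disjoint connectors. The invariant also keeps finished connectors
  away from the port sets not yet treated, since otherwise a later set could lose a port.\<close>

lemma connect_sets:
  assumes S: "finite S" "card S \<le> 3" and K: "K \<le> k"
    and Q: "\<And>i. i < K \<Longrightarrow> Q i \<subseteq> {0..<n} - low - S \<and> Q i \<noteq> {} \<and> card (Q i) \<le> 3"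
    and disj: "\<And>i j. \<lbrakk>i < K; j < K; i \<noteq> j\<rbrakk> \<Longrightarrow> Q i \<inter> Q j = {}"
    and "j \<le> K"
  shows "\<exists>W. (\<forall>i<j. Q i \<subseteq> W i \<and> W i \<subseteq> {0..<n} - low - S \<and> card (W i) \<le> 3 * (2 * I + 2)
            \<and> connected_graph (W i) (induced E (W i)) \<and> (\<forall>l<K. j \<le> l \<longrightarrow> W i \<inter> Q l = {})) \<and>
         (\<forall>i<j. \<forall>l<j. i \<noteq> l \<longrightarrow> W i \<inter> W l = {})"
  using assms(6)
proof (induction j)
  case (Suc j)
  then have "j \<le> K" by simp
  from Suc.IH[OF this] obtain W where W0: "\<forall>i<j. Q i \<subseteq> W i \<and> W i \<subseteq> {0..<n} - low - S \<and> card (W i) \<le> 3 * (2 * I + 2)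
            \<and> connected_graph (W i) (induced E (W i)) \<and> (\<forall>l<K. j \<le> l \<longrightarrow> W i \<inter> Q l = {})"
    and W1: "\<forall>i<j. \<forall>l<j. i \<noteq> l \<longrightarrow> W i \<inter> W l = {}"
    by (elim exE conjE)
  have W: "Q i \<subseteq> W i" "W i \<subseteq> {0..<n} - low - S" "card (W i) \<le> 3 * (2 * I + 2)"
      "connected_graph (W i) (induced E (W i))" "\<And>l. \<lbrakk>l < K; j \<le> l\<rbrakk> \<Longrightarrow> W i \<inter> Q l = {}"
    if "i < j" for i
    using W0 that by simp_all
  have Wd: "W i \<inter> W l = {}" if "i < j" "l < j" "i \<noteq> l" for i l
    using W1 that by blast
  \<comment> \<open>All that the new connector has to avoid: S, the finished connectors and the port
    sets still waiting.\<close>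
  define X where "X = S \<union> ((\<Union>i\<in>{..<j}. W i) \<union> (\<Union>i\<in>{j<..<K}. Q i))"
  have fQ: "finite (Q i)" if "i < K" for i using Q[OF that] finite_subset[of "Q i" "{0..<n}"] by blast
  have fW: "finite (W i)" if "i < j" for i using W(2)[OF that] finite_subset[of "W i" "{0..<n}"] by blast
  have fX: "finite X" using fQ fW S by (auto simp: X_def)
  have 1: "card (\<Union>i\<in>{..<j}. W i) \<le> k * (3 * (2 * I + 2))"
  proof -
    have "card (\<Union>i\<in>{..<j}. W i) \<le> (\<Sum>i<j. card (W i))" by (rule card_UN_le) simp
    also have "\<dots> \<le> (\<Sum>i<j. 3 * (2 * I + 2))" using W(3) by (intro sum_mono) simp
    also have "\<dots> = j * (3 * (2 * I + 2))" by simp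
    also have "\<dots> \<le> k * (3 * (2 * I + 2))" using Suc.prems K by (intro mult_le_mono1) simp
    finally show ?thesis .
  qed
  have 2: "card (\<Union>i\<in>{j<..<K}. Q i) \<le> k * 3"
  proof -
    have "card (\<Union>i\<in>{j<..<K}. Q i) \<le> (\<Sum>i\<in>{j<..<K}. card (Q i))" by (rule card_UN_le) simp
    also have "\<dots> \<le> (\<Sum>i\<in>{j<..<K}. 3)" using Q by (intro sum_mono) simp
    also have "\<dots> \<le> k * 3" using K by simp
    finally show ?thesis .
  qed
  have "card X \<le> card S + (card (\<Union>i\<in>{..<j}. W i) + card (\<Union>i\<in>{j<..<K}. Q i))"
    unfolding X_def by (meson card_Un_le add_left_mono le_trans)
  \<comment> \<open>\<open>kt\<close> is exactly this budget: 3 for S, 3k for waiting ports, 3k(2I +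
    2) for finished connectors.\<close>
  then have cX: "card X \<le> t" using 1 2 S(2) kt by (simp add: algebra_simps)
  have jK: "j < K" using Suc.prems by simp
  have QX: "Q j \<inter> X = {}"
  proof -
    have "Q j \<inter> S = {}" using Q[OF jK] by blast
    moreover have "Q j \<inter> W i = {}" if "i < j" for i using W(5)[OF that jK] by blast
    moreover have "Q j \<inter> Q i = {}" if "j < i" "i < K" for i using disj[OF jK that(2)] that by blast
    ultimately show ?thesis unfolding X_def
      by (simp add: Int_Un_distrib Int_UN_distrib)
  qed
  have "Q j \<subseteq> {0..<n} - low - X" using Q[OF jK] QX by blast
  from connect_set[OF fX cX refl fQ[OF jK] _ this] Q[OF jK]
  obtain V where V: "V \<subseteq> {0..<n} - low - X" "Q j \<subseteq> V" "card V \<le> card (Q j) * (2 * I + 2)"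
    "connected_graph V (induced E V)" by blast
  have "card (Q j) * (2 * I + 2) \<le> 3 * (2 * I + 2)" using Q[OF jK] by (intro mult_le_mono1) blast
  then have cV: "card V \<le> 3 * (2 * I + 2)" using V(3) by linarith
  have VS: "V \<subseteq> {0..<n} - low - S" using V(1) by (auto simp: X_def)
  have VW: "V \<inter> W i = {}" if "i < j" for i using V(1) that by (auto simp: X_def)
  have VQ: "V \<inter> Q l = {}" if "l < K" "Suc j \<le> l" for l using V(1) that by (auto simp: X_def)
  let ?W = "W(j := V)"
  have "Q i \<subseteq> ?W i \<and> ?W i \<subseteq> {0..<n} - low - S \<and> card (?W i) \<le> 3 * (2 * I + 2)
      \<and> connected_graph (?W i) (induced E (?W i)) \<and> (\<forall>l<K. Suc j \<le> l \<longrightarrow> ?W i \<inter> Q l = {})"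
    if "i < Suc j" for i
  proof (cases "i = j")
    case True
    then show ?thesis using V(2,4) VS cV VQ by simp
  next
    case False
    then have "i < j" using that by simp
    then show ?thesis using W(1-5)[of i] False by simp
  qed
  moreover have "?W i \<inter> ?W l = {}" if "i < Suc j" "l < Suc j" "i \<noteq> l" for i l
    using that VW[of i] VW[of l] Wd[of i l] by (auto simp: less_Suc_eq)
  ultimately show ?case by (intro exI[of _ ?W]) blast
qed simp

text \<open>Edges with both ends in S are discarded before a spanning tree is chosen. Vertex sets
  meeting only in S then force edge-disjointness, and the edges inside S stay free for one further
  tree.\<close>

lemma tree_through:
  assumes S: "S \<subseteq> {0..<n}" "S \<noteq> {}" and W: "W \<subseteq> {0..<n}" "W \<inter> S = {}" "connected_graph W (induced E W)"
    and adj: "\<And>x. x \<in> S \<Longrightarrow> N x \<inter> W \<noteq> {}"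
  shows "\<exists>F. subtree n E (S \<union> W) F \<and> (\<forall>e\<in>F. \<not> e \<subseteq> S)"
proof -
  let ?F0 = "{e \<in> induced E (S \<union> W). \<not> e \<subseteq> S}"
  have sub: "?F0 \<subseteq> E" by (auto simp: induced_def)
  have "connected_graph (S \<union> W) ?F0"
  proof (rule connected_graph_attach[OF W(3)])
    show "induced E W \<subseteq> ?F0"
    proof
      fix e assume e: "e \<in> induced E W"
      then have "card e = 2" using edges by (auto simp: induced_def all_edges_def)
      then have "e \<noteq> {}" by auto
      then show "e \<in> ?F0" using e W(2) by (auto simp: induced_def)
    qed
    show "finite S" using S finite_subset by blast
    show "\<exists>z\<in>W. {z, x} \<in> ?F0" if x: "x \<in> S" for x
    proof -
      obtain z where z: "z \<in> N x" "z \<in> W" using adj[OF x] by blast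
      then have "{z, x} \<in> ?F0" using x W(2) by (auto simp: induced_def nbrs_def insert_commute)
      then show ?thesis using z(2) by blast
    qed
  qed
  moreover have "?F0 \<subseteq> {e. e \<subseteq> S \<union> W \<and> card e = 2}"
    using edges by (auto simp: induced_def all_edges_def)
  moreover have "finite ?F0" using sub finite_E finite_subset by blast
  moreover have "finite (S \<union> W)" using S W finite_subset by blast
  ultimately obtain F where "F \<subseteq> ?F0" "is_tree (S \<union> W) F"
    using spanning_tree_exists[of "S \<union> W" ?F0] S(2) by auto
  then show ?thesis using S W sub by (intro exI[of _ F]) (auto simp: subtree_def)
qed

text \<open>The i-th ports of the three vertices of S form the i-th port set, so a connector of it
  is adjacent to all of S. The clause on edges inside S serves the exceptional case, where a tree
  lying inside S is added.\<close>

lemma tree_packing_from_ports: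
  assumes S: "S \<subseteq> {0..<n}" "card S = 3" and K: "K \<le> k"
    and Z: "\<And>x. x \<in> S \<Longrightarrow> Z x \<subseteq> N x - S - low \<and> card (Z x) = K"
    and disj: "\<And>x y. \<lbrakk>x \<in> S; y \<in> S; x \<noteq> y\<rbrakk> \<Longrightarrow> Z x \<inter> Z y = {}"
  shows "\<exists>T. tree_packing n E S K T \<and> (\<forall>i<K. \<forall>e\<in>snd (T i). \<not> e \<subseteq> S)"
proof -
  have fS: "finite S" using S finite_subset by blast
  have fZ: "finite (Z x)" if "x \<in> S" for x using Z[OF that] N_finite[of x] by (meson finite_Diff finite_subset)
  have "\<exists>h. bij_betw h {0..<K} (Z x)" if "x \<in> S" for x
    using ex_bij_betw_nat_finite[OF fZ[OF that]] Z[OF that] by simp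
  then obtain h where h: "\<And>x. x \<in> S \<Longrightarrow> bij_betw (h x) {0..<K} (Z x)" by metis
  have hZ: "h x i \<in> Z x" if "x \<in> S" "i < K" for x i
    using bij_betwE[OF h[OF that(1)]] that(2) by simp
  have hinj: "i = j" if "x \<in> S" "i < K" "j < K" "h x i = h x j" for x i j
    using bij_betw_imp_inj_on[OF h[OF that(1)]] that by (auto dest: inj_onD)
  define Q where "Q i = (\<lambda>x. h x i) ` S" for i
  have Q: "Q i \<subseteq> {0..<n} - low - S \<and> Q i \<noteq> {} \<and> card (Q i) \<le> 3" if i: "i < K" for i
  proof -
    have "Q i \<subseteq> {0..<n} - low - S"
    proof
      fix y assume "y \<in> Q i"
      then obtain x where x: "x \<in> S" "y = h x i" by (auto simp: Q_def)
      then have "y \<in> N x - S - low" using hZ[OF x(1) i] Z[OF x(1)] by blast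
      then show "y \<in> {0..<n} - low - S" using nbrs_all_edges(1)[OF edges, of y x] by simp
    qed
    moreover have "Q i \<noteq> {}" using S(2) by (auto simp: Q_def)
    moreover have "card (Q i) \<le> 3" using card_image_le[OF fS, of "\<lambda>x. h x i"] S(2) by (simp add: Q_def)
    ultimately show ?thesis by blast
  qed
  have Qd: "Q i \<inter> Q j = {}" if ij: "i < K" "j < K" "i \<noteq> j" for i j
  proof (rule ccontr)
    assume "Q i \<inter> Q j \<noteq> {}"
    then obtain x y where xy: "x \<in> S" "y \<in> S" "h x i = h y j" by (auto simp: Q_def)
    then have "x = y" using disj[OF xy(1,2)] hZ[OF xy(1) ij(1)] hZ[OF xy(2) ij(2)] by auto
    then show False using hinj[OF xy(1) ij(1,2)] xy ij by simp
  qed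
  have "\<exists>W. (\<forall>i<K. Q i \<subseteq> W i \<and> W i \<subseteq> {0..<n} - low - S \<and> card (W i) \<le> 3 * (2 * I + 2)
            \<and> connected_graph (W i) (induced E (W i)) \<and> (\<forall>l<K. K \<le> l \<longrightarrow> W i \<inter> Q l = {})) \<and>
         (\<forall>i<K. \<forall>l<K. i \<noteq> l \<longrightarrow> W i \<inter> W l = {})"
    using fS S(2) K Q Qd by (intro connect_sets[where K = K]) simp_all
  then obtain W where W0: "\<forall>i<K. Q i \<subseteq> W i \<and> W i \<subseteq> {0..<n} - low - S \<and> card (W i) \<le> 3 * (2 * I + 2)
            \<and> connected_graph (W i) (induced E (W i)) \<and> (\<forall>l<K. K \<le> l \<longrightarrow> W i \<inter> Q l = {})"
    and W1: "\<forall>i<K. \<forall>l<K. i \<noteq> l \<longrightarrow> W i \<inter> W l = {}"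
    by (elim exE conjE)
  have W: "Q i \<subseteq> W i" "W i \<subseteq> {0..<n} - low - S" "connected_graph (W i) (induced E (W i))"
    if "i < K" for i
    using W0 that by simp_all
  have Wd: "W i \<inter> W l = {}" if "i < K" "l < K" "i \<noteq> l" for i l
    using W1 that by blast
  have WS: "W i \<inter> S = {}" if "i < K" for i using W(2)[OF that] by blast
  have "\<exists>F. subtree n E (S \<union> W i) F \<and> (\<forall>e\<in>F. \<not> e \<subseteq> S)" if i: "i < K" for i
  proof (rule tree_through[OF S(1) _ _ WS[OF i] W(3)[OF i]])
    show "W i \<subseteq> {0..<n}" using W(2)[OF i] by blast
    show "S \<noteq> {}" using S(2) by auto
    show "N x \<inter> W i \<noteq> {}" if "x \<in> S" for x
      using hZ[OF that i] Z[OF that] W(1)[OF i] that by (auto simp: Q_def)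
  qed
  then obtain F where F: "\<And>i. i < K \<Longrightarrow> subtree n E (S \<union> W i) (F i)"
    "\<And>i e. i < K \<Longrightarrow> e \<in> F i \<Longrightarrow> \<not> e \<subseteq> S" by metis
  let ?T = "\<lambda>i. (S \<union> W i, F i)"
  have "F i \<inter> F j = {}" if ij: "i < K" "j < K" "i \<noteq> j" for i j
  proof (rule ccontr)
    assume "F i \<inter> F j \<noteq> {}"
    then obtain e where e: "e \<in> F i" "e \<in> F j" by blast
    then have "e \<subseteq> S \<union> W i" "e \<subseteq> S \<union> W j"
      using F(1)[OF ij(1)] F(1)[OF ij(2)] by (auto simp: subtree_def is_tree_def)
    then have "e \<subseteq> S" using Wd[OF ij] by blast
    then show False using F(2)[OF ij(1) e(1)] by blast
  qed
  moreover have "(S \<union> W i) \<inter> (S \<union> W j) = S" if ij: "i < K" "j < K" "i \<noteq> j" for i j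
    using Wd[OF ij] by blast
  ultimately have "tree_packing n E S K ?T" using F(1) by (simp add: tree_packing_def)
  then show ?thesis using F(2) by (intro exI[of _ ?T]) simp
qed

text \<open>An instance of \<open>disjoint_representatives\<close>. Low vertices have disjoint
  neighbourhoods and no low neighbours, so removing \<open>low\<close> costs them nothing. The
  others have at least 2t neighbours, of which at most one is low and at most three lie in S, and 2t
  - 4 is at least 3K.\<close>

lemma ports_exist:
  assumes S: "S \<subseteq> {0..<n}" "card S = 3" and K: "K \<le> k"
    and L: "\<And>x. x \<in> S \<inter> low \<Longrightarrow> K \<le> card (N x - S)"
  shows "\<exists>Z. (\<forall>x\<in>S. Z x \<subseteq> N x - S - low \<and> card (Z x) = K) \<and>
    (\<forall>x\<in>S. \<forall>y\<in>S. x \<noteq> y \<longrightarrow> Z x \<inter> Z y = {})"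
proof -
  have fS: "finite S" using S finite_subset by blast
  have eq: "S \<inter> low \<union> (S - low) = S" by blast
  have "\<exists>Z. (\<forall>x\<in>S \<inter> low \<union> (S - low). Z x \<subseteq> N x - S - low \<and> card (Z x) = K) \<and>
    (\<forall>x\<in>S \<inter> low \<union> (S - low). \<forall>y\<in>S \<inter> low \<union> (S - low). x \<noteq> y \<longrightarrow> Z x \<inter> Z y = {})"
  proof (rule disjoint_representatives)
    show "K \<le> card (N x - S - low)" if "x \<in> S \<inter> low" for x
    proof -
      have "N x - S - low = N x - S" using low_not_adjacent[of x] that by blast
      then show ?thesis using L[OF that] by simp
    qed
    show "K * card (S \<inter> low \<union> (S - low)) \<le> card (N x - S - low)" if "x \<in> S - low" for x
    proof -
      have "2 * t \<le> card (N x)" using that S(1) by (auto simp: low_def)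
      moreover have "card (N x) \<le> card (N x - S - low) + card (N x \<inter> low) + card S"
      proof -
        have "card (N x) \<le> card ((N x - S - low) \<union> (N x \<inter> low) \<union> S)"
          using fS by (intro card_mono) auto
        also have "\<dots> \<le> card (N x - S - low) + card (N x \<inter> low) + card S"
          by (meson card_Un_le add_le_mono1 le_trans)
        finally show ?thesis .
      qed
      ultimately have "2 * t \<le> card (N x - S - low) + 4" using card_low_nbrs[of x] S(2) by linarith
      then show ?thesis unfolding eq using S(2) kt K k by simp
    qed
    show "(N x - S - low) \<inter> (N y - S - low) = {}" if "x \<in> S \<inter> low" "y \<in> S \<inter> low" "x \<noteq> y" for x y
      using low_nbrs_disjoint[of x y] that by blast
  qed (use fS in auto)
  then show ?thesis unfolding eq .
qed

text \<open>Degree k + 1 leaves k ports to a low vertex with at most one neighbour in S. If a low x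
  is adjacent to both other vertices of S, these are not low, so only x can be short of
  ports.\<close>

lemma tree_packing_exists:
  assumes S: "S \<subseteq> {0..<n}" "card S = 3"
  shows "\<exists>T. tree_packing n E S k T"
proof (cases "\<exists>x\<in>S \<inter> low. card (N x \<inter> S) \<ge> 2")
  case False
  have "k \<le> card (N x - S)" if "x \<in> S \<inter> low" for x
  proof -
    have "k + 1 \<le> card (N x)" using that S(1) by (intro min_degree) auto
    moreover have "card (N x \<inter> S) \<le> 1" using False that by force
    moreover have "card (N x) = card (N x \<inter> S) + card (N x - S)"
      using card_Int_Diff[OF N_finite] by simp
    ultimately show ?thesis by linarith
  qed
  then show ?thesis
    using ports_exist[OF S order_refl] tree_packing_from_ports[OF S order_refl] by metis
next
  case True
  \<comment> \<open>x may have only k - 1 neighbours outside S, so the last tree uses the two edges inside S.\<close>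
  then obtain x where x: "x \<in> S" "x \<in> low" "2 \<le> card (N x \<inter> S)" by blast
  have fS: "finite S" using S finite_subset by blast
  have sub: "N x \<inter> S \<subseteq> S - {x}" using nbrs_subset[OF edges] by blast
  have c2: "card (S - {x}) = 2" using S(2) x fS by simp
  have NS: "N x \<inter> S = S - {x}"
    using card_seteq[OF _ sub] fS c2 x(3) by simp
  have only: "y = x" if "y \<in> S \<inter> low" for y
    using low_not_adjacent[OF x(2), of y] that NS by blast
  have "k - 1 \<le> card (N y - S)" if "y \<in> S \<inter> low" for y
  proof -
    have "k + 1 \<le> card (N x)" using x(2) by (intro min_degree) (simp add: low_def)
    moreover have "card (N x) = card (N x \<inter> S) + card (N x - S)"
      using card_Int_Diff[OF N_finite] by simp
    ultimately show ?thesis using only[OF that] NS c2 by simp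
  qed
  then obtain T where T: "tree_packing n E S (k - 1) T" "\<And>i e. i < k - 1 \<Longrightarrow> e \<in> snd (T i) \<Longrightarrow> \<not> e \<subseteq> S"
    using ports_exist[OF S, of "k - 1"] tree_packing_from_ports[OF S, of "k - 1"] by (metis diff_le_self)
  have "connected_graph (S - {x} \<union> {x}) (induced E S)"
  proof (rule connected_graph_attach[of _ "{}"])
    show "\<exists>z\<in>{x}. {z, y} \<in> induced E S" if "y \<in> S - {x}" for y
    proof -
      have "y \<in> N x" using that NS by blast
      then show ?thesis using that x(1) by (auto simp: nbrs_def induced_def)
    qed
  qed (use fS in \<open>auto simp: connected_graph_def\<close>)
  then have "connected_graph S (induced E S)" using x(1) by (simp add: insert_absorb)
  moreover have "induced E S \<subseteq> {e. e \<subseteq> S \<and> card e = 2}"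
    using edges by (auto simp: induced_def all_edges_def)
  moreover have "finite (induced E S)" by (simp add: induced_def)
  ultimately obtain F where F: "F \<subseteq> induced E S" "is_tree S F"
    using spanning_tree_exists[of S "induced E S"] fS x(1) by blast
  then have FS: "subtree n E S F" "\<And>e. e \<in> F \<Longrightarrow> e \<subseteq> S" using S(1)
    by (auto simp: subtree_def induced_def)
  let ?T = "T(k - 1 := (S, F))"
  have T1: "subtree n E (fst (T i)) (snd (T i)) \<and> S \<subseteq> fst (T i)" if "i < k - 1" for i
    using T(1) that by (simp add: tree_packing_def)
  have T2: "snd (T i) \<inter> snd (T j) = {} \<and> fst (T i) \<inter> fst (T j) = S" if "i < k - 1" "j < k - 1" "i \<noteq> j" for i j
    using T(1) that by (simp add: tree_packing_def)
  have lt: "i = k - 1 \<or> i < k - 1" if "i < k" for i using that by linarith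
  \<comment> \<open>Trees built from ports have no edge inside S, while all edges of F lie inside
    S.\<close>
  have new: "snd (T i) \<inter> F = {} \<and> fst (T i) \<inter> S = S" if "i < k - 1" for i
    using T1[OF that] T(2)[OF that] FS(2) by blast
  have "subtree n E (fst (?T i)) (snd (?T i)) \<and> S \<subseteq> fst (?T i)" if "i < k" for i
    using lt[OF that] T1 FS by auto
  moreover have "snd (?T i) \<inter> snd (?T j) = {} \<and> fst (?T i) \<inter> fst (?T j) = S"
    if "i < k" "j < k" "i \<noteq> j" for i j
    using lt[OF that(1)] lt[OF that(2)] T2[of i j] new[of i] new[of j] that(3)
    by (auto simp: Int_commute)
  ultimately have "tree_packing n E S k ?T" unfolding tree_packing_def by blast
  then show ?thesis by blast
qed

text \<open>Places two given vertices in a common 3-set; with u = v it shows that 3-sets exist at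
  all.\<close>

lemma triple_through:
  assumes "u < n" "v < n"
  obtains S where "S \<subseteq> {0..<n}" "card S = 3" "u \<in> S" "v \<in> S"
proof -
  have "card {u, v} \<le> 3" by (cases "u = v") auto
  then have "\<exists>S. {u, v} \<subseteq> S \<and> S \<subseteq> {0..<n} \<and> card S = 3"
    by (rule exists_subset_between) (use assms n in simp_all)
  then obtain S where S: "{u, v} \<subseteq> S" "S \<subseteq> {0..<n}" "card S = 3"
    by (elim exE conjE)
  have "u \<in> S" "v \<in> S" using S(1) by simp_all
  with S show thesis by (intro that)
qed

text \<open>\<open>kappa3\<close> is 0 on disconnected graphs, so connectivity has to be shown too:
  any two vertices lie in a 3-set, and since k is at least 1 a tree connecting that set joins
  them.\<close>

lemma kappa3_ge: "k \<le> kappa3 n E"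
proof -
  have "(\<lambda>x y. {x, y} \<in> E)\<^sup>*\<^sup>* u v" if uv: "u < n" "v < n" for u v
  proof -
    obtain S where S: "S \<subseteq> {0..<n}" "card S = 3" "u \<in> S" "v \<in> S"
      by (rule triple_through[OF uv])
    obtain T where "tree_packing n E S k T" using tree_packing_exists[OF S(1,2)] by blast
    then have T: "subtree n E (fst (T 0)) (snd (T 0))" "S \<subseteq> fst (T 0)"
      using k by (auto simp: tree_packing_def)
    then have "connected_graph (fst (T 0)) E"
      using connected_graph_mono by (auto simp: subtree_def is_tree_def)
    then show ?thesis using T(2) S by (auto simp: connected_graph_def)
  qed
  then have "connected_graph {0..<n} E" by (simp add: connected_graph_def)
  moreover have "k \<le> Min {kappaS n E S | S. S \<subseteq> {0..<n} \<and> card S = 3}"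
  proof (subst Min_ge_iff)
    have "{kappaS n E S | S. S \<subseteq> {0..<n} \<and> card S = 3} \<subseteq> kappaS n E ` Pow {0..<n}" by blast
    then show "finite {kappaS n E S | S. S \<subseteq> {0..<n} \<and> card S = 3}" using finite_subset by blast
    obtain S where "S \<subseteq> {0..<n}" "card S = 3" by (rule triple_through[of 0 0]) (use n in auto)
    then show "{kappaS n E S | S. S \<subseteq> {0..<n} \<and> card S = 3} \<noteq> {}" by blast
    show "\<forall>m\<in>{kappaS n E S | S. S \<subseteq> {0..<n} \<and> card S = 3}. k \<le> m"
      using tree_packing_exists kappaS_ge by fastforce
  qed
  ultimately show ?thesis by (simp add: kappa3_def)
qed

end

section \<open>Probability estimates\<close>

lemma prob_UN_le:
  assumes "finite A" "X \<subseteq> (\<Union>x\<in>A. B x)" "\<And>x. x \<in> A \<Longrightarrow> measure_pmf.prob M (B x) \<le> c x"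
  shows "measure_pmf.prob M X \<le> (\<Sum>x\<in>A. c x)"
proof -
  have "measure_pmf.prob M X \<le> measure_pmf.prob M (\<Union>x\<in>A. B x)"
    using assms(2) by (intro measure_pmf.finite_measure_mono) auto
  also have "\<dots> \<le> (\<Sum>x\<in>A. measure_pmf.prob M (B x))"
    using assms(1) by (intro measure_pmf.finite_measure_subadditive_finite) auto
  also have "\<dots> \<le> (\<Sum>x\<in>A. c x)" using assms(3) by (rule sum_mono)
  finally show ?thesis .
qed

text \<open>Markov's inequality for a product of independent edge weights.\<close>

lemma Gnp_prob_le:
  fixes a b :: "nat set \<Rightarrow> real"
  assumes p: "0 \<le> p" "p \<le> 1" and c: "0 \<le> c"
    and ab: "\<And>e. 0 \<le> a e" "\<And>e. 0 \<le> b e"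
    and le: "\<And>E. \<lbrakk>E \<subseteq> all_edges n; E \<in> X\<rbrakk> \<Longrightarrow> 1 \<le> c * (\<Prod>e\<in>all_edges n. if e \<in> E then a e else b e)"
  shows "measure_pmf.prob (Gnp n p) X \<le> c * (\<Prod>e\<in>all_edges n. p * a e + (1 - p) * b e)"
proof -
  define P where "P = Pi_pmf (all_edges n) False (\<lambda>_. bernoulli_pmf p)"
  define g where "g e v = (if v then a e else b e)" for e v
  let ?Y = "{f. {e \<in> all_edges n. f e} \<in> X}"
  have int: "integrable (measure_pmf (bernoulli_pmf p)) (g e)" for e
    by (rule integrable_measure_pmf_finite) simp
  have "measure_pmf.prob (Gnp n p) X = measure_pmf.prob P ?Y"
    by (simp add: Gnp_def P_def vimage_def)
  also have "\<dots> = measure_pmf.expectation P (indicator ?Y)"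
    by simp
  also have "\<dots> \<le> measure_pmf.expectation P (\<lambda>f. c * (\<Prod>e\<in>all_edges n. g e (f e)))"
  proof (rule integral_mono)
    show "integrable (measure_pmf P) (indicator ?Y :: _ \<Rightarrow> real)"
      by (rule measure_pmf.integrable_const_bound[where B = 1]) (auto simp: indicator_def)
    show "integrable (measure_pmf P) (\<lambda>f. c * (\<Prod>e\<in>all_edges n. g e (f e)))"
      unfolding P_def by (intro integrable_mult_right integrable_prod_Pi_pmf int) simp
    fix f :: "nat set \<Rightarrow> bool"
    have "(\<Prod>e\<in>all_edges n. g e (f e)) =
        (\<Prod>e\<in>all_edges n. if e \<in> {e \<in> all_edges n. f e} then a e else b e)"
      by (rule prod.cong) (auto simp: g_def)
    moreover have "0 \<le> c * (\<Prod>e\<in>all_edges n. g e (f e))"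
      using c ab by (intro mult_nonneg_nonneg prod_nonneg) (auto simp: g_def)
    ultimately show "indicator ?Y f \<le> c * (\<Prod>e\<in>all_edges n. g e (f e))"
      using le[of "{e \<in> all_edges n. f e}"] by (auto simp: indicator_def)
  qed
  also have "\<dots> = c * (\<Prod>e\<in>all_edges n. measure_pmf.expectation (bernoulli_pmf p) (g e))"
    unfolding P_def by (simp, subst expectation_prod_Pi_pmf) (use int ab in \<open>auto simp: g_def[abs_def]\<close>)
  also have "\<dots> = c * (\<Prod>e\<in>all_edges n. p * a e + (1 - p) * b e)"
    using p by (simp add: g_def mult.commute)
  finally show ?thesis .
qed

lemma prod_two_classes:
  fixes x y :: real
  assumes "finite A" "F1 \<subseteq> A" "F2 \<subseteq> A" "F1 \<inter> F2 = {}"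
  shows "(\<Prod>e\<in>A. if e \<in> F1 then x else if e \<in> F2 then y else 1) = x ^ card F1 * y ^ card F2"
proof -
  have "(\<Prod>e\<in>A. if e \<in> F1 then x else if e \<in> F2 then y else 1)
      = (\<Prod>e\<in>A. (if e \<in> F1 then x else 1) * (if e \<in> F2 then y else 1))"
    using assms(4) by (intro prod.cong) auto
  also have "\<dots> = (\<Prod>e\<in>A \<inter> F1. x) * (\<Prod>e\<in>A \<inter> F2. y)"
    using assms(1) by (simp add: prod.distrib prod.If_cases)
  finally show ?thesis using assms by (simp add: Int_absorb1)
qed

text \<open>With weight 0 for a violation and 1 otherwise, the product of the weights is the
  indicator of the event.\<close>

lemma prob_edges_present_absent:
  assumes p: "0 \<le> p" "p \<le> 1" and F: "F1 \<subseteq> all_edges n" "F2 \<subseteq> all_edges n" "F1 \<inter> F2 = {}"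
  shows "measure_pmf.prob (Gnp n p) {E. F1 \<subseteq> E \<and> F2 \<inter> E = {}} \<le> p ^ card F1 * (1 - p) ^ card F2"
proof -
  let ?a = "\<lambda>e. if e \<in> F2 then 0 else 1 :: real" and ?b = "\<lambda>e. if e \<in> F1 then 0 else 1 :: real"
  have "measure_pmf.prob (Gnp n p) {E. F1 \<subseteq> E \<and> F2 \<inter> E = {}}
      \<le> 1 * (\<Prod>e\<in>all_edges n. p * ?a e + (1 - p) * ?b e)"
  proof (rule Gnp_prob_le[OF p])
    fix E assume "E \<in> {E. F1 \<subseteq> E \<and> F2 \<inter> E = {}}"
    then have "(\<Prod>e\<in>all_edges n. if e \<in> E then ?a e else ?b e) = (\<Prod>e\<in>all_edges n. 1)"
      by (intro prod.cong) auto
    then show "1 \<le> 1 * (\<Prod>e\<in>all_edges n. if e \<in> E then ?a e else ?b e)" by simp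
  qed auto
  also have "\<dots> = (\<Prod>e\<in>all_edges n. if e \<in> F1 then p else if e \<in> F2 then 1 - p else 1)"
    using F(3) by (auto intro!: prod.cong)
  also have "\<dots> = p ^ card F1 * (1 - p) ^ card F2"
    by (rule prod_two_classes) (use F in auto)
  finally show ?thesis .
qed

lemma one_minus_power_le_exp:
  fixes x :: real
  assumes "x \<le> 1"
  shows "(1 - x) ^ m \<le> exp (- x * real m)"
proof -
  have "(1 - x) ^ m \<le> exp (- x) ^ m"
    using assms exp_ge_add_one_self[of "- x"] by (intro power_mono) auto
  then show ?thesis by (simp add: exp_of_nat_mult[symmetric] mult.commute)
qed

lemma four_power_le_exp: "4 ^ m \<le> exp (2 * real m)"
proof -
  have "(4::real) \<le> exp 1 * exp 1"
    using mult_mono[OF exp_ge_add_one_self[of 1] exp_ge_add_one_self[of 1]] by simp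
  then have "(4::real) \<le> exp 2" by (simp flip: exp_add)
  then have "(4::real) ^ m \<le> exp 2 ^ m" by (intro power_mono) auto
  then show ?thesis by (simp add: exp_of_nat_mult[symmetric] mult.commute)
qed

text \<open>An exponential moment bound: a pair in F2 has weight 1/4 when present, hence expected
  weight 1 - 3p/4, and at most r present edges keep the product at least 4^(-r). The factor 4^r is
  absorbed by 4 <= e^2.\<close>

lemma prob_edges_present_few:
  assumes p: "0 \<le> p" "p \<le> 1" and F: "F1 \<subseteq> all_edges n" "F2 \<subseteq> all_edges n" "F1 \<inter> F2 = {}"
  shows "measure_pmf.prob (Gnp n p) {E. F1 \<subseteq> E \<and> card (F2 \<inter> E) \<le> r}
    \<le> p ^ card F1 * exp (2 * real r - 3 / 4 * p * real (card F2))"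
proof -
  let ?a = "\<lambda>e. if e \<in> F2 then 1 / 4 else 1 :: real" and ?b = "\<lambda>e. if e \<in> F1 then 0 else 1 :: real"
  have "measure_pmf.prob (Gnp n p) {E. F1 \<subseteq> E \<and> card (F2 \<inter> E) \<le> r}
      \<le> 4 ^ r * (\<Prod>e\<in>all_edges n. p * ?a e + (1 - p) * ?b e)"
  proof (rule Gnp_prob_le[OF p])
    fix E assume E: "E \<in> {E. F1 \<subseteq> E \<and> card (F2 \<inter> E) \<le> r}"
    have "(\<Prod>e\<in>all_edges n. if e \<in> E then ?a e else ?b e) =
        (\<Prod>e\<in>all_edges n. if e \<in> {} then 1 else if e \<in> F2 \<inter> E then 1 / 4 else 1)"
      using E by (intro prod.cong) auto
    also have "\<dots> = (1 / 4) ^ card (F2 \<inter> E)"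
      by (subst prod_two_classes) (use F in auto)
    finally have eq: "(\<Prod>e\<in>all_edges n. if e \<in> E then ?a e else ?b e) = 1 / 4 ^ card (F2 \<inter> E)"
      by (simp add: power_one_over)
    have "(4::real) ^ card (F2 \<inter> E) \<le> 4 ^ r" using E by (intro power_increasing) auto
    then show "1 \<le> 4 ^ r * (\<Prod>e\<in>all_edges n. if e \<in> E then ?a e else ?b e)"
      unfolding eq by (simp add: field_simps)
  qed auto
  also have "(\<Prod>e\<in>all_edges n. p * ?a e + (1 - p) * ?b e)
      = (\<Prod>e\<in>all_edges n. if e \<in> F1 then p else if e \<in> F2 then 1 - 3 / 4 * p else 1)"
    using F(3) by (auto intro!: prod.cong)
  also have "\<dots> = p ^ card F1 * (1 - 3 / 4 * p) ^ card F2"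
    by (rule prod_two_classes) (use F in auto)
  finally have 1: "measure_pmf.prob (Gnp n p) {E. F1 \<subseteq> E \<and> card (F2 \<inter> E) \<le> r}
      \<le> 4 ^ r * (p ^ card F1 * (1 - 3 / 4 * p) ^ card F2)" .
  have 2: "4 ^ r * (1 - 3 / 4 * p) ^ card F2 \<le> exp (2 * real r) * exp (- (3 / 4 * p) * real (card F2))"
    using p by (intro mult_mono four_power_le_exp one_minus_power_le_exp) auto
  have "4 ^ r * (p ^ card F1 * (1 - 3 / 4 * p) ^ card F2)
      \<le> p ^ card F1 * (exp (2 * real r) * exp (- (3 / 4 * p) * real (card F2)))"
    using mult_left_mono[OF 2, of "p ^ card F1"] p by (simp add: mult_ac)
  with 1 show ?thesis by (simp flip: exp_add)
qed

section \<open>Degrees and low vertices\<close>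

lemma star_edges:
  assumes "x < n" "J \<subseteq> {0..<n} - {x}"
  shows "(\<lambda>y. {x, y}) ` J \<subseteq> all_edges n" "card ((\<lambda>y. {x, y}) ` J) = card J"
proof -
  show "(\<lambda>y. {x, y}) ` J \<subseteq> all_edges n" using assms by (auto simp: all_edges_def card_insert_if)
  show "card ((\<lambda>y. {x, y}) ` J) = card J"
    by (rule card_image) (auto simp: inj_on_def doubleton_eq_iff)
qed

text \<open>Union bound over the exact neighbourhood J of x with |J| = j <= k; the other pairs at x,
  at least n - 1 - k of them, are absent. The condition np >= 1 lets the power with j = k
  dominate.\<close>

lemma prob_degree_le:
  assumes p: "0 \<le> p" "p \<le> 1" and np: "1 \<le> real n * p" and "x < n"
  shows "measure_pmf.prob (Gnp n p) {E. E \<subseteq> all_edges n \<and> card (nbrs E x) \<le> k}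
    \<le> (real k + 1) * (real n * p) ^ k * exp (- p * (real n - 1 - real k))"
proof -
  let ?V = "{0..<n} - {x}" and ?s = "\<lambda>J. (\<lambda>y. {x, y}) ` J"
  let ?B = "\<lambda>J. {E. ?s J \<subseteq> E \<and> ?s (?V - J) \<inter> E = {}}"
  let ?c = "exp (- p * (real n - 1 - real k))"
  have cV: "card ?V = n - 1" using assms(4) by simp
  have J: "measure_pmf.prob (Gnp n p) (?B J) \<le> p ^ j * ?c" if "J \<subseteq> ?V" "card J = j" "j \<le> k" for J j
  proof -
    have "measure_pmf.prob (Gnp n p) (?B J) \<le> p ^ card (?s J) * (1 - p) ^ card (?s (?V - J))"
      by (rule prob_edges_present_absent[OF p])
        (use that star_edges[OF \<open>x < n\<close>] in \<open>auto simp: doubleton_eq_iff\<close>)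
    also have "card (?s J) = j" using star_edges(2)[OF \<open>x < n\<close> that(1)] that(2) by simp
    also have "card (?s (?V - J)) = n - 1 - j"
      using star_edges(2)[OF \<open>x < n\<close>, of "?V - J"] card_Diff_subset[OF finite_subset[OF that(1)] that(1)]
        that(2) cV by simp
    also have "(1 - p) ^ (n - 1 - j) \<le> exp (- p * real (n - 1 - j))"
      using p by (intro one_minus_power_le_exp) auto
    also have "\<dots> \<le> ?c"
    proof -
      have "real n - 1 - real k \<le> real (n - 1 - j)" using that(3) by linarith
      then show ?thesis using p by (simp add: mult_left_mono)
    qed
    finally show ?thesis using p by (simp add: mult_left_mono)
  qed
  have "measure_pmf.prob (Gnp n p) {E. E \<subseteq> all_edges n \<and> card (nbrs E x) \<le> k}
      \<le> (\<Sum>j\<in>{..k}. real n ^ j * (p ^ j * ?c))"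
  proof (rule prob_UN_le[where B = "\<lambda>j. \<Union>J\<in>{J. J \<subseteq> ?V \<and> card J = j}. ?B J"])
    show "{E. E \<subseteq> all_edges n \<and> card (nbrs E x) \<le> k} \<subseteq>
        (\<Union>j\<in>{..k}. \<Union>J\<in>{J. J \<subseteq> ?V \<and> card J = j}. ?B J)"
    proof
      fix E assume "E \<in> {E. E \<subseteq> all_edges n \<and> card (nbrs E x) \<le> k}"
      then have E: "E \<subseteq> all_edges n" "card (nbrs E x) \<le> k" by auto
      have "E \<in> ?B (nbrs E x)" by (auto simp: nbrs_def)
      moreover have "nbrs E x \<in> {J. J \<subseteq> ?V \<and> card J = card (nbrs E x)}"
        using nbrs_subset[OF E(1)] by simp
      ultimately show "E \<in> (\<Union>j\<in>{..k}. \<Union>J\<in>{J. J \<subseteq> ?V \<and> card J = j}. ?B J)"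
        using E(2) by (intro UN_I[of "card (nbrs E x)"] UN_I[of "nbrs E x"]) simp_all
    qed
    fix j assume j: "j \<in> {..k}"
    have "measure_pmf.prob (Gnp n p) (\<Union>J\<in>{J. J \<subseteq> ?V \<and> card J = j}. ?B J)
        \<le> (\<Sum>J\<in>{J. J \<subseteq> ?V \<and> card J = j}. p ^ j * ?c)"
      by (rule prob_UN_le[OF _ order_refl]) (use J j in auto)
    also have "\<dots> = real ((n - 1) choose j) * (p ^ j * ?c)"
      using n_subsets[of ?V j] cV by simp
    also have "\<dots> \<le> real n ^ j * (p ^ j * ?c)"
    proof (rule mult_right_mono)
      have "(n - 1) choose j \<le> (n - 1) ^ j"
        by (cases "j \<le> n - 1") (auto intro: binomial_le_pow simp: binomial_eq_0)
      also have "\<dots> \<le> n ^ j" by (intro power_mono) auto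
      finally show "real ((n - 1) choose j) \<le> real n ^ j" by (simp flip: of_nat_power)
    qed (use p in simp)
    finally show "measure_pmf.prob (Gnp n p) (\<Union>J\<in>{J. J \<subseteq> ?V \<and> card J = j}. ?B J)
        \<le> real n ^ j * (p ^ j * ?c)" .
  qed simp
  also have "\<dots> = (\<Sum>j\<le>k. (real n * p) ^ j * ?c)" by (simp add: power_mult_distrib mult.assoc)
  also have "\<dots> \<le> (\<Sum>j\<le>k. (real n * p) ^ k * ?c)"
    using np by (intro sum_mono mult_right_mono power_increasing) auto
  also have "\<dots> = (real k + 1) * (real n * p) ^ k * ?c" by simp
  finally show ?thesis .
qed

lemma prob_min_degree_le:
  assumes "0 \<le> p" "p \<le> 1" "1 \<le> real n * p"
  shows "measure_pmf.prob (Gnp n p) {E. E \<subseteq> all_edges n \<and> (\<exists>x<n. card (nbrs E x) \<le> k)}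
    \<le> real n * ((real k + 1) * (real n * p) ^ k * exp (- p * (real n - 1 - real k)))"
proof -
  let ?c = "(real k + 1) * (real n * p) ^ k * exp (- p * (real n - 1 - real k))"
  have "measure_pmf.prob (Gnp n p) {E. E \<subseteq> all_edges n \<and> (\<exists>x<n. card (nbrs E x) \<le> k)}
    \<le> (\<Sum>x\<in>{..<n}. ?c)"
    by (rule prob_UN_le[where B = "\<lambda>x. {E. E \<subseteq> all_edges n \<and> card (nbrs E x) \<le> k}"])
      (use prob_degree_le[OF assms] in auto)
  then show ?thesis by simp
qed

text \<open>Only neighbours outside T are counted: the stars from x and y to the rest are disjoint
  from each other and from F, hence independent. Together they have at least 2(n - 3) pairs, of
  which at most 2r are present.\<close>

lemma prob_two_low:
  assumes p: "0 \<le> p" "p \<le> 1" and xy: "x < n" "y < n" "x \<noteq> y"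
    and T: "T \<subseteq> {0..<n}" "x \<in> T" "y \<in> T" "card T \<le> 3"
    and F: "F \<subseteq> all_edges n" "\<And>e. e \<in> F \<Longrightarrow> e \<subseteq> T"
  shows "measure_pmf.prob (Gnp n p)
      {E. E \<subseteq> all_edges n \<and> F \<subseteq> E \<and> card (nbrs E x) \<le> r \<and> card (nbrs E y) \<le> r}
    \<le> p ^ card F * exp (4 * real r - 3 / 2 * p * (real n - 3))"
proof -
  let ?V = "{0..<n} - T"
  let ?Fx = "(\<lambda>z. {x, z}) ` ?V" and ?Fy = "(\<lambda>z. {y, z}) ` ?V"
  have fT: "finite T" using T(1) finite_subset by blast
  have sub: "?V \<subseteq> {0..<n} - {x}" "?V \<subseteq> {0..<n} - {y}" using T by auto
  have cV: "real n - 3 \<le> real (card ?V)"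
    using card_Diff_subset[OF fT T(1)] T(4) by simp
  have "?Fx \<inter> ?Fy = {}" using T xy by (auto simp: doubleton_eq_iff)
  then have cF: "card (?Fx \<union> ?Fy) = 2 * card ?V"
    using star_edges(2)[OF xy(1) sub(1)] star_edges(2)[OF xy(2) sub(2)]
    by (subst card_Un_disjoint) auto
  have "measure_pmf.prob (Gnp n p)
      {E. E \<subseteq> all_edges n \<and> F \<subseteq> E \<and> card (nbrs E x) \<le> r \<and> card (nbrs E y) \<le> r}
    \<le> measure_pmf.prob (Gnp n p) {E. F \<subseteq> E \<and> card ((?Fx \<union> ?Fy) \<inter> E) \<le> 2 * r}"
  proof (rule measure_pmf.finite_measure_mono)
    show "{E. E \<subseteq> all_edges n \<and> F \<subseteq> E \<and> card (nbrs E x) \<le> r \<and> card (nbrs E y) \<le> r}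
      \<subseteq> {E. F \<subseteq> E \<and> card ((?Fx \<union> ?Fy) \<inter> E) \<le> 2 * r}"
    proof clarify
      fix E assume E: "E \<subseteq> all_edges n" "card (nbrs E x) \<le> r" "card (nbrs E y) \<le> r"
      have "card ((?Fx \<union> ?Fy) \<inter> E) \<le>
          card ((\<lambda>z. {x, z}) ` nbrs E x \<union> (\<lambda>z. {y, z}) ` nbrs E y)"
        using finite_nbrs[OF E(1)] by (intro card_mono) (auto simp: nbrs_def)
      also have "\<dots> \<le> card ((\<lambda>z. {x, z}) ` nbrs E x) + card ((\<lambda>z. {y, z}) ` nbrs E y)"
        by (rule card_Un_le)
      also have "\<dots> \<le> card (nbrs E x) + card (nbrs E y)"
        using finite_nbrs[OF E(1)] by (intro add_mono card_image_le)
      finally show "card ((?Fx \<union> ?Fy) \<inter> E) \<le> 2 * r" using E by simp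
    qed
  qed simp
  also have "\<dots> \<le> p ^ card F * exp (2 * real (2 * r) - 3 / 4 * p * real (card (?Fx \<union> ?Fy)))"
    by (rule prob_edges_present_few[OF p F(1)])
      (use star_edges(1)[OF xy(1) sub(1)] star_edges(1)[OF xy(2) sub(2)] F(2) in auto)
  also have "\<dots> \<le> p ^ card F * exp (4 * real r - 3 / 2 * p * (real n - 3))"
  proof (intro mult_left_mono)
    have "3 / 2 * p * (real n - 3) \<le> 3 / 2 * p * real (card ?V)"
      using cV p by (intro mult_left_mono) auto
    then show "exp (2 * real (2 * r) - 3 / 4 * p * real (card (?Fx \<union> ?Fy)))
        \<le> exp (4 * real r - 3 / 2 * p * (real n - 3))"
      unfolding cF by simp
  qed (use p in simp)
  finally show ?thesis .
qed

text \<open>Closeness is witnessed by an edge, in at most n^2 ways with a factor p, or by a path of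
  length two, in at most n^3 ways with a factor p^2.\<close>

lemma prob_low_close:
  assumes p: "0 \<le> p" "p \<le> 1"
  shows "measure_pmf.prob (Gnp n p) {E. E \<subseteq> all_edges n \<and> (\<exists>x<n. \<exists>y<n. x \<noteq> y \<and>
      card (nbrs E x) \<le> r \<and> card (nbrs E y) \<le> r \<and> ({x, y} \<in> E \<or> nbrs E x \<inter> nbrs E y \<noteq> {}))}
    \<le> (real n ^ 2 * p + real n ^ 3 * p ^ 2) * exp (4 * real r - 3 / 2 * p * (real n - 3))"
    (is "measure_pmf.prob _ ?X \<le> _")
proof -
  let ?c = "exp (4 * real r - 3 / 2 * p * (real n - 3))"
  let ?V = "{..<n}"
  let ?P = "\<lambda>x y F. {E. E \<subseteq> all_edges n \<and> F \<subseteq> E \<and> card (nbrs E x) \<le> r \<and> card (nbrs E y) \<le> r}"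
  \<comment> \<open>Degenerate tuples get the empty event, so that the union bounds may run over
    full products.\<close>
  let ?A = "\<lambda>x y. if x = y then {} else ?P x y {{x, y}}"
  let ?B = "\<lambda>x y z. if x = y \<or> x = z \<or> y = z then {} else ?P x y {{x, z}, {y, z}}"
  have A: "measure_pmf.prob (Gnp n p) (?A x y) \<le> p * ?c" if "x < n" "y < n" for x y
  proof (cases "x = y")
    case False
    have "measure_pmf.prob (Gnp n p) (?P x y {{x, y}}) \<le> p ^ card {{x, y}} * ?c"
      by (rule prob_two_low[OF p that False, where T = "{x, y}"])
        (use that False in \<open>auto simp: all_edges_def\<close>)
    then show ?thesis using False by simp
  qed (use p in simp)
  have B: "measure_pmf.prob (Gnp n p) (?B x y z) \<le> p ^ 2 * ?c" if "x < n" "y < n" "z < n" for x y z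
  proof (cases "x = y \<or> x = z \<or> y = z")
    case False
    have "measure_pmf.prob (Gnp n p) (?P x y {{x, z}, {y, z}}) \<le> p ^ card {{x, z}, {y, z}} * ?c"
      by (rule prob_two_low[OF p that(1,2), where T = "{x, y, z}"])
        (use that False in \<open>auto simp: all_edges_def\<close>)
    moreover have "{x, z} \<noteq> {y, z}" using False by (auto simp: doubleton_eq_iff)
    then have "card {{x, z}, {y, z}} = 2" by simp
    ultimately show ?thesis using False by simp
  qed (use p in simp)
  define X1 where "X1 = (\<Union>q\<in>?V \<times> ?V. ?A (fst q) (snd q))"
  define X2 where "X2 = (\<Union>q\<in>?V \<times> ?V \<times> ?V. ?B (fst q) (fst (snd q)) (snd (snd q)))"
  have 1: "measure_pmf.prob (Gnp n p) X1 \<le> (\<Sum>q\<in>?V \<times> ?V. p * ?c)"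
  proof (rule prob_UN_le[OF _ eq_refl[OF X1_def]])
    fix q assume "q \<in> ?V \<times> ?V"
    then show "measure_pmf.prob (Gnp n p) (?A (fst q) (snd q)) \<le> p * ?c" by (intro A) auto
  qed simp
  have 2: "measure_pmf.prob (Gnp n p) X2 \<le> (\<Sum>q\<in>?V \<times> ?V \<times> ?V. p ^ 2 * ?c)"
  proof (rule prob_UN_le[OF _ eq_refl[OF X2_def]])
    fix q assume "q \<in> ?V \<times> ?V \<times> ?V"
    then show "measure_pmf.prob (Gnp n p) (?B (fst q) (fst (snd q)) (snd (snd q))) \<le> p ^ 2 * ?c"
      by (intro B) auto
  qed simp
  have sub: "?X \<subseteq> X1 \<union> X2"
  proof
    fix E assume "E \<in> ?X"
    then obtain x y where xy: "E \<subseteq> all_edges n" "x < n" "y < n" "x \<noteq> y"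
      "card (nbrs E x) \<le> r" "card (nbrs E y) \<le> r" "{x, y} \<in> E \<or> nbrs E x \<inter> nbrs E y \<noteq> {}"
      by blast
    from xy(7) show "E \<in> X1 \<union> X2"
    proof
      assume "{x, y} \<in> E"
      then have "E \<in> ?A (fst (x, y)) (snd (x, y))" using xy by simp
      then have "E \<in> X1" unfolding X1_def using xy by (intro UN_I[of "(x, y)"]) auto
      then show ?thesis by blast
    next
      assume "nbrs E x \<inter> nbrs E y \<noteq> {}"
      then obtain z where z: "z \<in> nbrs E x" "z \<in> nbrs E y" by blast
      then have zn: "z < n" "x \<noteq> z" "y \<noteq> z" using nbrs_all_edges[OF xy(1)] by blast+
      have "E \<in> ?B (fst (x, y, z)) (fst (snd (x, y, z))) (snd (snd (x, y, z)))"
        using xy z zn by (simp add: nbrs_def)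
      then have "E \<in> X2" unfolding X2_def using xy zn by (intro UN_I[of "(x, y, z)"]) auto
      then show ?thesis by blast
    qed
  qed
  have "measure_pmf.prob (Gnp n p) ?X \<le> measure_pmf.prob (Gnp n p) (X1 \<union> X2)"
    using sub by (intro measure_pmf.finite_measure_mono) auto
  also have "\<dots> \<le> measure_pmf.prob (Gnp n p) X1 + measure_pmf.prob (Gnp n p) X2"
    by (intro measure_Un_le) auto
  also have "\<dots> \<le> real n * real n * (p * ?c) + real n * (real n * real n) * (p ^ 2 * ?c)"
    using 1 2 by (simp add: card_cartesian_product mult.assoc)
  also have "\<dots> = (real n ^ 2 * p + real n ^ 3 * p ^ 2) * ?c"
    by (simp add: algebra_simps power2_eq_square power3_eq_cube)
  finally show ?thesis .
qed

section \<open>Union bounds over vertex sets\<close>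

lemma sum_Pow_power_card:
  fixes x :: real
  assumes "finite V"
  shows "(\<Sum>Y\<in>Pow V. x ^ card Y) = (1 + x) ^ card V"
  using prod_add[OF assms, of "\<lambda>_. x" "\<lambda>_. 1"] by (simp add: add.commute)

text \<open>As x <= 1, every counted set Y has x^r <= x^|Y|, and x^|Y| summed over all subsets gives
  (1 + x)^|V|.\<close>

lemma card_small_subsets_le:
  fixes x :: real
  assumes "finite V" "0 < x" "x \<le> 1"
  shows "real (card {Y. Y \<subseteq> V \<and> card Y \<le> r}) * x ^ r \<le> exp (x * real (card V))"
proof -
  have "real (card {Y. Y \<subseteq> V \<and> card Y \<le> r}) * x ^ r = (\<Sum>Y\<in>{Y. Y \<subseteq> V \<and> card Y \<le> r}. x ^ r)"
    by simp
  also have "\<dots> \<le> (\<Sum>Y\<in>{Y. Y \<subseteq> V \<and> card Y \<le> r}. x ^ card Y)"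
    using assms by (intro sum_mono power_decreasing) auto
  also have "\<dots> \<le> (\<Sum>Y\<in>Pow V. x ^ card Y)"
    using assms by (intro sum_mono2) auto
  also have "\<dots> = (1 + x) ^ card V" using assms by (simp add: sum_Pow_power_card)
  also have "\<dots> \<le> exp x ^ card V" using assms exp_ge_add_one_self[of x] by (intro power_mono) auto
  also have "\<dots> = exp (x * real (card V))" by (simp add: exp_of_nat_mult[symmetric] mult.commute)
  finally show ?thesis .
qed

lemma binomial_le_exp_power:
  assumes "1 \<le> a"
  shows "real (n choose a) \<le> (exp 1 * real n / real a) ^ a"
proof (cases "a \<le> n")
  case True
  \<comment> \<open>The choice x = a/n turns exp (x n) / x^a into (e n / a)^a.\<close>
  define x where "x = real a / real n"
  have x: "0 < x" "x \<le> 1" using True assms by (auto simp: x_def)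
  have "real (n choose a) * x ^ a \<le> real (card {Y. Y \<subseteq> {0..<n} \<and> card Y \<le> a}) * x ^ a"
  proof (intro mult_right_mono)
    have "n choose a = card {Y. Y \<subseteq> {0..<n} \<and> card Y = a}" by (simp add: n_subsets)
    also have "\<dots> \<le> card {Y. Y \<subseteq> {0..<n} \<and> card Y \<le> a}" by (intro card_mono) auto
    finally show "real (n choose a) \<le> real (card {Y. Y \<subseteq> {0..<n} \<and> card Y \<le> a})" by simp
  qed (use x in simp)
  also have "\<dots> \<le> exp (x * real n)" using card_small_subsets_le[of "{0..<n}" x a] x by simp
  also have "x * real n = real a" using True assms by (simp add: x_def)
  finally have "real (n choose a) * x ^ a \<le> exp 1 ^ a" by (simp add: exp_of_nat_mult[symmetric])
  then have "real (n choose a) \<le> exp 1 ^ a / x ^ a" using x by (simp add: pos_le_divide_eq)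
  also have "\<dots> = (exp 1 * real n / real a) ^ a"
    by (simp add: x_def power_divide power_mult_distrib)
  finally show ?thesis .
qed (simp add: binomial_eq_0)

text \<open>Union over A of size a and over 2a of its at most a^2 pairs: (e n / a)^a (e a / 2)^(2a)
  p^(2a) is the summand.\<close>

lemma prob_dense_set:
  assumes p: "0 \<le> p" "p \<le> 1"
  shows "measure_pmf.prob (Gnp n p) {E. E \<subseteq> all_edges n \<and>
      (\<exists>A\<subseteq>{0..<n}. A \<noteq> {} \<and> card A \<le> m \<and> 2 * card A \<le> card (induced E A))}
    \<le> (\<Sum>a=1..m. (exp 3 * real n * real a * p ^ 2 / 4) ^ a)" (is "measure_pmf.prob _ ?X \<le> _")
proof -
  let ?S = "\<lambda>a. {A. A \<subseteq> {0..<n} \<and> card A = a}"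
  let ?pr = "\<lambda>A. {e. e \<subseteq> A \<and> card e = 2}"
  let ?T = "\<lambda>A. {F. F \<subseteq> ?pr A \<and> card F = 2 * card A}"
  have A: "measure_pmf.prob (Gnp n p) (\<Union>F\<in>?T A. {E. F \<subseteq> E}) \<le> (exp 1 * real a / 2) ^ (2 * a) * p ^ (2 * a)"
    if "A \<in> ?S a" "1 \<le> a" for A a
  proof -
    have fA: "finite A" using that finite_subset by blast
    have fpr: "finite (?pr A)" using fA by auto
    have cpr: "card (?pr A) \<le> a\<^sup>2"
    proof -
      have "card (?pr A) = a choose 2" using n_subsets[OF fA, of 2] that by simp
      also have "\<dots> \<le> a\<^sup>2"
        using binomial_le_pow[of 2 a] by (cases "2 \<le> a") (auto simp: binomial_eq_0)
      finally show ?thesis .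
    qed
    have "measure_pmf.prob (Gnp n p) (\<Union>F\<in>?T A. {E. F \<subseteq> E}) \<le> (\<Sum>F\<in>?T A. p ^ (2 * a))"
    proof (rule prob_UN_le[OF _ order_refl])
      show "finite (?T A)" using fpr by simp
      fix F assume F: "F \<in> ?T A"
      have "F \<subseteq> all_edges n" using F that by (auto simp: all_edges_def)
      then show "measure_pmf.prob (Gnp n p) {E. F \<subseteq> E} \<le> p ^ (2 * a)"
        using prob_edges_present_absent[OF p, of F n "{}"] F that by simp
    qed
    also have "\<dots> = real (card (?pr A) choose (2 * a)) * p ^ (2 * a)"
      using n_subsets[OF fpr, of "2 * a"] that by simp
    also have "\<dots> \<le> (exp 1 * real a / 2) ^ (2 * a) * p ^ (2 * a)"
    proof (intro mult_right_mono)
      have "real (card (?pr A) choose (2 * a)) \<le> (exp 1 * real (card (?pr A)) / real (2 * a)) ^ (2 * a)"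
        using that by (intro binomial_le_exp_power) simp
      also have "\<dots> \<le> (exp 1 * real (a\<^sup>2) / real (2 * a)) ^ (2 * a)"
        using cpr by (intro power_mono divide_right_mono mult_left_mono) (auto simp del: of_nat_power)
      also have "exp 1 * real (a\<^sup>2) / real (2 * a) = exp 1 * real a / 2"
        using that by (simp add: power2_eq_square)
      finally show "real (card (?pr A) choose (2 * a)) \<le> (exp 1 * real a / 2) ^ (2 * a)" .
    qed (use p in simp)
    finally show ?thesis .
  qed
  show ?thesis
  proof (rule prob_UN_le[where B = "\<lambda>a. \<Union>A\<in>?S a. \<Union>F\<in>?T A. {E. F \<subseteq> E}"])
    show "?X \<subseteq> (\<Union>a\<in>{1..m}. \<Union>A\<in>?S a. \<Union>F\<in>?T A. {E. F \<subseteq> E})"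
    proof
      fix E assume "E \<in> ?X"
      then obtain A where A: "E \<subseteq> all_edges n" "A \<subseteq> {0..<n}" "A \<noteq> {}" "card A \<le> m"
        "2 * card A \<le> card (induced E A)" by blast
      have "finite A" using A finite_subset by blast
      then have "1 \<le> card A" using A(3) by (simp add: Suc_leI card_gt_0_iff)
      moreover obtain F where F: "F \<subseteq> induced E A" "card F = 2 * card A"
        using A(5) by (meson obtain_subset_with_card_n)
      moreover have "F \<subseteq> ?pr A" "F \<subseteq> E" using F(1) A(1) by (auto simp: induced_def all_edges_def)
      ultimately show "E \<in> (\<Union>a\<in>{1..m}. \<Union>A\<in>?S a. \<Union>F\<in>?T A. {E. F \<subseteq> E})"
        using A by (intro UN_I[of "card A"] UN_I[of A] UN_I[of F]) auto
    qed
    fix a assume "a \<in> {1..m}"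
    then have a: "1 \<le> a" by simp
    have "measure_pmf.prob (Gnp n p) (\<Union>A\<in>?S a. \<Union>F\<in>?T A. {E. F \<subseteq> E})
        \<le> (\<Sum>A\<in>?S a. (exp 1 * real a / 2) ^ (2 * a) * p ^ (2 * a))"
      by (rule prob_UN_le[OF _ order_refl]) (use A a in auto)
    also have "\<dots> = real (n choose a) * ((exp 1 * real a / 2) ^ (2 * a) * p ^ (2 * a))"
      using n_subsets[of "{0..<n}" a] by simp
    also have "\<dots> \<le> (exp 1 * real n / real a) ^ a * ((exp 1 * real a / 2) ^ (2 * a) * p ^ (2 * a))"
      using p by (intro mult_right_mono binomial_le_exp_power a) auto
    also have "\<dots> = (exp 1 * real n / real a * ((exp 1 * real a / 2)\<^sup>2 * p\<^sup>2)) ^ a"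
      by (simp only: power_mult power_mult_distrib)
    also have "exp 1 * real n / real a * ((exp 1 * real a / 2)\<^sup>2 * p\<^sup>2) = (exp 1) ^ 3 * real n * real a * p ^ 2 / 4"
      using a by (simp add: field_simps power2_eq_square power3_eq_cube)
    also have "(exp 1 :: real) ^ 3 = exp 3" by (simp add: exp_of_nat_mult[symmetric])
    finally show "measure_pmf.prob (Gnp n p) (\<Union>A\<in>?S a. \<Union>F\<in>?T A. {E. F \<subseteq> E})
        \<le> (exp 3 * real n * real a * p ^ 2 / 4) ^ a" .
  qed simp
qed

text \<open>The parameter x is the weight in the generating function that counts small subsets.\<close>

lemma prob_not_joined:
  assumes p: "0 \<le> p" "p \<le> 1" and x: "0 < x" "x \<le> 1"
  shows "measure_pmf.prob (Gnp n p) {E. E \<subseteq> all_edges n \<and>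
      (\<exists>A B. A \<subseteq> {0..<n} \<and> B \<subseteq> {0..<n} \<and> A \<inter> B = {} \<and> s \<le> card A \<and> n \<le> (M + 3) * card B \<and>
        n \<le> card B + (M + 2) * card A \<and> (\<forall>a\<in>A. \<forall>b\<in>B. {a, b} \<notin> E))}
    \<le> (\<Sum>a=s..n. exp (2 * x * real n) / x ^ ((M + 2) * a) * exp (- p * real a * real n / (real M + 3)))"
    (is "measure_pmf.prob _ ?X \<le> _")
proof -
  let ?S = "\<lambda>a. {A. A \<subseteq> {0..<n} \<and> card A = a}"
  let ?U = "\<lambda>r. {Y. Y \<subseteq> {0..<n} \<and> card Y \<le> r}"
  let ?F = "\<lambda>A B. (\<lambda>(a, b). {a, b}) ` (A \<times> B)"
  let ?R = "\<lambda>A Y. {0..<n} - A - Y"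
  let ?B = "\<lambda>A Y. if n \<le> (M + 3) * card (?R A Y) then {E. ?F A (?R A Y) \<inter> E = {}} else {}"
  let ?q = "\<lambda>a. exp (- p * real a * real n / (real M + 3))"
  have B: "measure_pmf.prob (Gnp n p) (?B A Y) \<le> ?q a" if A: "A \<in> ?S a" for A Y a
  proof (cases "n \<le> (M + 3) * card (?R A Y)")
    case True
    let ?R = "?R A Y"
    have "inj_on (\<lambda>(a, b). {a, b}) (A \<times> ?R)"
      by (auto simp: inj_on_def doubleton_eq_iff)
    then have c: "card (?F A ?R) = a * card ?R"
      using A by (simp add: card_image card_cartesian_product)
    have "measure_pmf.prob (Gnp n p) {E. {} \<subseteq> E \<and> ?F A ?R \<inter> E = {}} \<le> p ^ card ({} :: nat set set) * (1 - p) ^ card (?F A ?R)"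
      by (rule prob_edges_present_absent[OF p]) (use A in \<open>auto simp: all_edges_def card_insert_if\<close>)
    also have "\<dots> \<le> exp (- p * real (a * card ?R))"
      using p by (simp only: c) (simp add: one_minus_power_le_exp[of p "a * card ?R", simplified])
    also have "\<dots> \<le> ?q a"
    proof -
      have "real n \<le> (real M + 3) * real (card ?R)"
        using True by (metis of_nat_add of_nat_le_iff of_nat_mult of_nat_numeral)
      then have "real n / (real M + 3) \<le> real (card ?R)" by (simp add: divide_le_eq mult.commute)
      then have "p * real a * (real n / (real M + 3)) \<le> p * real a * real (card ?R)"
        using p by (intro mult_left_mono) auto
      then show ?thesis by simp
    qed
    finally show ?thesis using True by simp
  qed simp
  show ?thesis
  proof (rule prob_UN_le[where B = "\<lambda>a. \<Union>A\<in>?S a. \<Union>Y\<in>?U ((M + 1) * a). ?B A Y"])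
    show "?X \<subseteq> (\<Union>a\<in>{s..n}. \<Union>A\<in>?S a. \<Union>Y\<in>?U ((M + 1) * a). ?B A Y)"
    proof
      fix E assume "E \<in> ?X"
      then obtain A B where A: "A \<subseteq> {0..<n}" "B \<subseteq> {0..<n}" "A \<inter> B = {}" "s \<le> card A"
        "n \<le> (M + 3) * card B" "n \<le> card B + (M + 2) * card A" "\<forall>a\<in>A. \<forall>b\<in>B. {a, b} \<notin> E" by blast
      \<comment> \<open>B itself has too many candidates, but what lies outside A and B is small: n
        <= |B| + (M + 2) |A| gives |Y| <= (M + 1) |A|. Hence the union runs over Y.\<close>
      define Y where "Y = {0..<n} - (A \<union> B)"
      have fin: "finite A" "finite B" using A finite_subset by blast+
      have R: "?R A Y = B" using A by (auto simp: Y_def)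
      have "card (A \<union> B) = card A + card B" using fin A(3) by (rule card_Un_disjoint)
      then have "card Y = n - (card A + card B)"
        unfolding Y_def using A fin by (subst card_Diff_subset) auto
      then have "card Y \<le> (M + 1) * card A" using A(6) by simp
      then have "Y \<in> ?U ((M + 1) * card A)" by (auto simp: Y_def)
      moreover have "card A \<in> {s..n}" using A(4) card_mono[OF _ A(1)] by simp
      moreover have "E \<in> ?B A Y" unfolding R using A(5,7) by auto
      ultimately show "E \<in> (\<Union>a\<in>{s..n}. \<Union>A\<in>?S a. \<Union>Y\<in>?U ((M + 1) * a). ?B A Y)"
        using A(1) by (intro UN_I[of "card A"] UN_I[of A] UN_I[of Y]) simp_all
    qed
    fix a assume "a \<in> {s..n}"
    have U: "real (card (?U r)) \<le> exp (x * real n) / x ^ r" for r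
      using card_small_subsets_le[of "{0..<n}" x r] x by (simp add: pos_le_divide_eq)
    have S: "real (card (?S a)) \<le> exp (x * real n) / x ^ a"
    proof -
      have "card (?S a) \<le> card (?U a)" by (intro card_mono) auto
      then show ?thesis using U[of a] by linarith
    qed
    have "measure_pmf.prob (Gnp n p) (\<Union>A\<in>?S a. \<Union>Y\<in>?U ((M + 1) * a). ?B A Y)
        \<le> (\<Sum>A\<in>?S a. \<Sum>Y\<in>?U ((M + 1) * a). ?q a)"
    proof (rule prob_UN_le[OF _ order_refl])
      fix A assume "A \<in> ?S a"
      then show "measure_pmf.prob (Gnp n p) (\<Union>Y\<in>?U ((M + 1) * a). ?B A Y) \<le> (\<Sum>Y\<in>?U ((M + 1) * a). ?q a)"
        by (intro prob_UN_le[OF _ order_refl] B) auto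
    qed simp
    also have "\<dots> = real (card (?S a)) * real (card (?U ((M + 1) * a))) * ?q a" by simp
    also have "\<dots> \<le> exp (x * real n) / x ^ a * (exp (x * real n) / x ^ ((M + 1) * a)) * ?q a"
      using x by (intro mult_right_mono mult_mono S U) auto
    also have "\<dots> = exp (2 * x * real n) / x ^ ((M + 2) * a) * ?q a"
    proof -
      have "exp (2 * x * real n) = exp (x * real n) * exp (x * real n)" by (simp flip: exp_add)
      moreover have "x ^ ((M + 2) * a) = x ^ a * x ^ ((M + 1) * a)"
        by (simp add: power_add[symmetric] algebra_simps)
      ultimately show ?thesis by simp
    qed
    finally show "measure_pmf.prob (Gnp n p) (\<Union>A\<in>?S a. \<Union>Y\<in>?U ((M + 1) * a). ?B A Y)
        \<le> exp (2 * x * real n) / x ^ ((M + 2) * a) * ?q a" .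
  qed simp
qed

section \<open>Combining the four failure events\<close>

lemma set_pmf_Gnp: "E \<in> set_pmf (Gnp n p) \<Longrightarrow> E \<subseteq> all_edges n"
  by (auto simp: Gnp_def)

text \<open>The four subtracted terms bound, in this order, the failure of
  \<open>min_degree\<close>, \<open>low_apart\<close>, \<open>sparse\<close> and
  \<open>joined\<close>.\<close>

lemma prob_kappa3_ge:
  assumes p: "0 \<le> p" "p \<le> 1" and np: "1 \<le> real n * p" and x: "0 < x" "x \<le> 1"
    and par: "1 \<le> k" "3 \<le> n" "1 < M" "n < M ^ I" "4 * M + 1 \<le> t" "t \<le> s" "(M + 3) * s \<le> n"
      "3 + 3 * k + 3 * k * (2 * I + 2) \<le> t"
  shows "1 - (real n * ((real k + 1) * (real n * p) ^ k * exp (- p * (real n - 1 - real k)))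
      + (real n ^ 2 * p + real n ^ 3 * p ^ 2) * exp (4 * real (2 * t) - 3 / 2 * p * (real n - 3))
      + (\<Sum>a=1..M * s. (exp 3 * real n * real a * p ^ 2 / 4) ^ a)
      + (\<Sum>a=s..n. exp (2 * x * real n) / x ^ ((M + 2) * a) * exp (- p * real a * real n / (real M + 3))))
    \<le> measure_pmf.prob (Gnp n p) {E. k \<le> kappa3 n E}"
    (is "1 - (?b1 + ?b2 + ?b3 + ?b4) \<le> measure_pmf.prob _ ?K")
proof -
  let ?P = "measure_pmf.prob (Gnp n p)"
  define X1 where "X1 = {E. E \<subseteq> all_edges n \<and> (\<exists>x<n. card (nbrs E x) \<le> k)}"
  \<comment> \<open>The non-strict bound 2t enlarges the event slightly and fits
    \<open>prob_low_close\<close>.\<close>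
  define X2 where "X2 = {E. E \<subseteq> all_edges n \<and> (\<exists>x<n. \<exists>y<n. x \<noteq> y \<and>
      card (nbrs E x) \<le> 2 * t \<and> card (nbrs E y) \<le> 2 * t \<and> ({x, y} \<in> E \<or> nbrs E x \<inter> nbrs E y \<noteq> {}))}"
  define X3 where "X3 = {E. E \<subseteq> all_edges n \<and>
      (\<exists>A\<subseteq>{0..<n}. A \<noteq> {} \<and> card A \<le> M * s \<and> 2 * card A \<le> card (induced E A))}"
  define X4 where "X4 = {E. E \<subseteq> all_edges n \<and>
      (\<exists>A B. A \<subseteq> {0..<n} \<and> B \<subseteq> {0..<n} \<and> A \<inter> B = {} \<and> s \<le> card A \<and> n \<le> (M + 3) * card B \<and>
        n \<le> card B + (M + 2) * card A \<and> (\<forall>a\<in>A. \<forall>b\<in>B. {a, b} \<notin> E))}"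
  have good: "E \<in> ?K" if E: "E \<subseteq> all_edges n" and X: "E \<notin> X1" "E \<notin> X2" "E \<notin> X3" "E \<notin> X4" for E
  proof -
    have "good_graph n k M s t I E"
    proof
      show "k + 1 \<le> card (nbrs E x)" if "x < n" for x
        using X(1) E that by (force simp: X1_def not_le)
      show "{x, y} \<notin> E \<and> nbrs E x \<inter> nbrs E y = {}"
        if "x < n" "y < n" "x \<noteq> y" "card (nbrs E x) < 2 * t" "card (nbrs E y) < 2 * t" for x y
        using X(2) E that less_imp_le unfolding X2_def by blast
      show "card (induced E A) < 2 * card A" if "A \<subseteq> {0..<n}" "A \<noteq> {}" "card A \<le> M * s" for A
        using X(3) E that not_less unfolding X3_def by blast
      show "\<exists>a\<in>A. \<exists>b\<in>B. {a, b} \<in> E"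
        if "A \<subseteq> {0..<n}" "B \<subseteq> {0..<n}" "A \<inter> B = {}" "s \<le> card A" "n \<le> (M + 3) * card B"
          "n \<le> card B + (M + 2) * card A" for A B
        using X(4) E that unfolding X4_def by blast
    qed (use E par in auto)
    then show ?thesis using good_graph.kappa3_ge by blast
  qed
  have "1 = ?P {E. E \<subseteq> all_edges n}"
    using set_pmf_Gnp by (subst measure_pmf.prob_eq_1[THEN iffD2]) (auto simp: AE_measure_pmf_iff)
  also have "\<dots> \<le> ?P (X1 \<union> X2 \<union> X3 \<union> X4 \<union> ?K)"
  proof (rule measure_pmf.finite_measure_mono)
    show "{E. E \<subseteq> all_edges n} \<subseteq> X1 \<union> X2 \<union> X3 \<union> X4 \<union> ?K"
    proof
      fix E assume "E \<in> {E. E \<subseteq> all_edges n}"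
      with good[of E] show "E \<in> X1 \<union> X2 \<union> X3 \<union> X4 \<union> ?K" by (simp only: Un_iff mem_Collect_eq) argo
    qed
  qed simp
  also have "\<dots> \<le> ?P X1 + ?P X2 + ?P X3 + ?P X4 + ?P ?K"
    using measure_Un_le[of X1 "measure_pmf (Gnp n p)" X2]
      measure_Un_le[of "X1 \<union> X2" "measure_pmf (Gnp n p)" X3]
      measure_Un_le[of "X1 \<union> X2 \<union> X3" "measure_pmf (Gnp n p)" X4]
      measure_Un_le[of "X1 \<union> X2 \<union> X3 \<union> X4" "measure_pmf (Gnp n p)" ?K]
    by simp
  also have "\<dots> \<le> ?b1 + ?b2 + ?b3 + ?b4 + ?P ?K"
    unfolding X1_def X2_def X3_def X4_def
    by (intro add_mono order_refl prob_min_degree_le[OF p np] prob_low_close[OF p]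
        prob_dense_set[OF p] prob_not_joined[OF p x])
  finally show ?thesis by simp
qed

section \<open>Asymptotics\<close>

text \<open>Comparison with a geometric series, y^a <= y (1/2)^(a - 1), when the bases depend on a
  but share a bound y.\<close>

lemma sum_powers_le:
  fixes y :: real
  assumes f: "\<And>a. a \<in> {1..m} \<Longrightarrow> 0 \<le> f a \<and> f a \<le> y" and y: "0 \<le> y" "y \<le> 1 / 2"
  shows "(\<Sum>a=1..m. f a ^ a) \<le> 2 * y"
proof -
  have "(\<Sum>a=1..m. f a ^ a) \<le> (\<Sum>a=1..m. y ^ a)"
    using f by (intro sum_mono power_mono) auto
  also have "\<dots> = (\<Sum>a<m. y ^ Suc a)"
    by (rule sum.reindex_bij_witness[of _ Suc "\<lambda>a. a - 1"]) auto
  also have "\<dots> \<le> (\<Sum>a<m. y * (1 / 2) ^ a)"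
    using y by (intro sum_mono) (auto intro!: mult_left_mono power_mono)
  also have "\<dots> = y * (\<Sum>a<m. (1 / 2) ^ a)" by (simp add: sum_distrib_left)
  also have "\<dots> \<le> y * 2"
    using y by (intro mult_left_mono) (simp add: sum_gp_strict)
  finally show ?thesis by simp
qed

text \<open>The lower-order terms are eventually nonnegative in total and at most ln n. Apart from
  the minimum degree, every error term is estimated from these crude bounds.\<close>

lemma threshold_bounds:
  fixes k :: nat
  defines "L \<equiv> \<lambda>n. ln (real n) + (real k + 1) * ln (ln (real n)) - ln (ln (ln (real n)))"
  shows "eventually (\<lambda>n. ln (real n) \<le> L n \<and> L n \<le> 2 * ln (real n)) sequentially"
proof -
  have "((\<lambda>n. ln (ln (real n)) / ln (real n)) \<longlongrightarrow> 0) sequentially" by real_asymp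
  then have "eventually (\<lambda>n. ln (ln (real n)) / ln (real n) < 1 / (real k + 1)) sequentially"
    by (rule order_tendstoD) simp
  moreover have "eventually (\<lambda>n. 1 \<le> ln (real n) \<and> 0 \<le> ln (ln (real n)) \<and> 0 \<le> ln (ln (ln (real n)))
      \<and> ln (ln (ln (real n))) \<le> ln (ln (real n))) sequentially"
    by (intro eventually_conj) real_asymp+
  ultimately show ?thesis
  proof eventually_elim
    case (elim n)
    then have "ln (ln (real n)) * (real k + 1) \<le> ln (real n)" by (simp add: field_simps)
    moreover have "ln (ln (real n)) \<le> (real k + 1) * ln (ln (real n))"
      using elim mult_right_mono[of 1 "real k + 1" "ln (ln (real n))"] by simp
    ultimately show ?case using elim by (simp add: L_def mult.commute)
  qed
qed

text \<open>The one estimate in which the lower-order terms of the density matter: exp (-np) equals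
  ln ln n / (n (ln n)^(k+1)), and the other factors are at most of order n (ln n)^k.\<close>

lemma min_degree_error_tendsto:
  fixes k :: nat
  defines "L \<equiv> \<lambda>n. ln (real n) + (real k + 1) * ln (ln (real n)) - ln (ln (ln (real n)))"
  defines "p \<equiv> \<lambda>n. L n / real n"
  shows "(\<lambda>n. real n * ((real k + 1) * (real n * p n) ^ k * exp (- p n * (real n - 1 - real k)))) \<longlonglongrightarrow> 0"
proof (rule tendsto_sandwich[OF _ _ tendsto_const])
  \<comment> \<open>2 ^ k comes from np <= 2 ln n, and exp (k + 1) from replacing n - 1 - k by n, as
    p <= 1.\<close>
  let ?c = "(real k + 1) * 2 ^ k * exp (real k + 1)"
  have "(\<lambda>n. ln (ln (real n)) / ln (real n)) \<longlonglongrightarrow> 0" by real_asymp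
  from tendsto_mult_left[OF this, of ?c]
  show "(\<lambda>n. ?c * (ln (ln (real n)) / ln (real n))) \<longlonglongrightarrow> 0" by simp
  have ev: "eventually (\<lambda>n. 0 < real n \<and> 1 < ln (real n) \<and> 1 \<le> ln (ln (real n)) \<and> 2 * ln (real n) \<le> real n) sequentially"
    by (intro eventually_conj) real_asymp+
  show "eventually (\<lambda>n. 0 \<le> real n * ((real k + 1) * (real n * p n) ^ k * exp (- p n * (real n - 1 - real k)))) sequentially"
    using ev threshold_bounds[of k] by eventually_elim (simp add: p_def L_def)
  show "eventually (\<lambda>n. real n * ((real k + 1) * (real n * p n) ^ k * exp (- p n * (real n - 1 - real k)))
      \<le> ?c * (ln (ln (real n)) / ln (real n))) sequentially"
    using ev threshold_bounds[of k]
  proof eventually_elim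
    case (elim n)
    let ?l = "ln (real n)"
    have np: "real n * p n = L n" using elim by (simp add: p_def)
    have L: "?l \<le> L n" "L n \<le> 2 * ?l" using elim by (auto simp: L_def)
    have p1: "p n \<le> 1" using L elim by (simp add: p_def)
    have "exp (- p n * (real n - 1 - real k)) = exp (- L n) * exp (p n * (real k + 1))"
      using np by (simp add: exp_add[symmetric] algebra_simps)
    also have "\<dots> \<le> exp (- L n) * exp (real k + 1)"
      using p1 mult_right_mono[of "p n" 1 "real k + 1"] by simp
    also have "exp (- L n) = ln ?l / (real n * ?l ^ (k + 1))"
    proof -
      have "exp ((real k + 1) * ln ?l) = ?l ^ (k + 1)"
        using elim exp_of_nat_mult[of "k + 1" "ln ?l"] by (simp add: algebra_simps)
      then show ?thesis using elim
        by (simp add: L_def exp_diff exp_add exp_minus field_simps)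
    qed
    finally have e: "exp (- p n * (real n - 1 - real k)) \<le> ln ?l / (real n * ?l ^ (k + 1)) * exp (real k + 1)" .
    have "(real n * p n) ^ k \<le> (2 * ?l) ^ k" unfolding np using L elim by (intro power_mono) auto
    then have "real n * ((real k + 1) * (real n * p n) ^ k * exp (- p n * (real n - 1 - real k)))
        \<le> real n * ((real k + 1) * (2 * ?l) ^ k * (ln ?l / (real n * ?l ^ (k + 1)) * exp (real k + 1)))"
      using e elim np L by (intro mult_left_mono mult_mono) auto
    also have "\<dots> = ?c * (ln ?l / ?l)"
      using elim by (simp add: power_mult_distrib field_simps)
    finally show ?case .
  qed
qed

lemma low_close_error_tendsto:
  fixes p :: "nat \<Rightarrow> real" and t :: "nat \<Rightarrow> nat"
  assumes p: "eventually (\<lambda>n. ln (real n) \<le> real n * p n \<and> real n * p n \<le> 2 * ln (real n)) sequentially"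
    and t: "eventually (\<lambda>n. real (t n) \<le> ln (real n) / 40) sequentially"
  shows "(\<lambda>n. (real n ^ 2 * p n + real n ^ 3 * p n ^ 2) * exp (4 * real (2 * t n) - 3 / 2 * p n * (real n - 3))) \<longlonglongrightarrow> 0"
proof (rule tendsto_sandwich[OF _ _ tendsto_const])
  \<comment> \<open>8t <= ln n / 5 and np >= ln n give -13/10 ln n, and the 5 covers (9/2) p. The
    power n^(-1.3) beats n (ln n)^2.\<close>
  let ?u = "\<lambda>n. (2 * real n * ln (real n) + 4 * real n * ln (real n) ^ 2) * exp (5 - 13 / 10 * ln (real n))"
  show "?u \<longlonglongrightarrow> 0" by real_asymp
  have ev: "eventually (\<lambda>n. 0 < real n \<and> 1 \<le> ln (real n) \<and> 2 * ln (real n) \<le> real n) sequentially"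
    by (intro eventually_conj) real_asymp+
  have bounds: "eventually (\<lambda>n. 0 \<le> p n \<and> (real n ^ 2 * p n + real n ^ 3 * p n ^ 2) * exp (4 * real (2 * t n) - 3 / 2 * p n * (real n - 3)) \<le> ?u n) sequentially"
    using ev p t
  proof eventually_elim
    case (elim n)
    let ?l = "ln (real n)"
    have np0: "0 \<le> real n * p n" using elim by linarith
    then have p0: "0 \<le> p n" using elim by (simp add: zero_le_mult_iff)
    have "real n * p n \<le> real n * 1" using elim by linarith
    then have p1: "p n \<le> 1" using elim by simp
    have "real n ^ 2 * p n + real n ^ 3 * p n ^ 2 = real n * (real n * p n) + real n * (real n * p n) ^ 2"
      by (simp add: power2_eq_square power3_eq_cube)
    also have "\<dots> \<le> real n * (2 * ?l) + real n * (2 * ?l) ^ 2"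
      using elim np0 by (intro add_mono mult_left_mono power_mono) auto
    finally have 1: "real n ^ 2 * p n + real n ^ 3 * p n ^ 2 \<le> 2 * real n * ?l + 4 * real n * ?l ^ 2"
      by (simp add: power_mult_distrib)
    have "3 / 2 * p n * (real n - 3) = 3 / 2 * (real n * p n) - 9 / 2 * p n" by (simp add: field_simps)
    moreover have "real (t n) \<le> ?l / 40" "?l \<le> real n * p n" using elim by auto
    ultimately have "4 * real (2 * t n) - 3 / 2 * p n * (real n - 3) \<le> 5 - 13 / 10 * ?l"
      using p1 by linarith
    with 1 show ?case using elim p0 by (auto intro!: mult_mono)
  qed
  then show "eventually (\<lambda>n. (real n ^ 2 * p n + real n ^ 3 * p n ^ 2) * exp (4 * real (2 * t n) - 3 / 2 * p n * (real n - 3)) \<le> ?u n) sequentially"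
    by eventually_elim simp
  from bounds show "eventually (\<lambda>n. 0 \<le> (real n ^ 2 * p n + real n ^ 3 * p n ^ 2) * exp (4 * real (2 * t n) - 3 / 2 * p n * (real n - 3))) sequentially"
    by eventually_elim simp
qed

text \<open>Here n a p^2 = a (np)^2 / n is at most 4 / ln n, since a <= n / (ln n)^3 and np <= 2 ln
  n; so all bases are at most e^3 / ln n.\<close>

lemma dense_set_error_tendsto:
  fixes p :: "nat \<Rightarrow> real" and m :: "nat \<Rightarrow> nat"
  assumes p: "eventually (\<lambda>n. ln (real n) \<le> real n * p n \<and> real n * p n \<le> 2 * ln (real n)) sequentially"
    and m: "eventually (\<lambda>n. real (m n) \<le> real n / ln (real n) ^ 3) sequentially"
  shows "(\<lambda>n. \<Sum>a=1..m n. (exp 3 * real n * real a * p n ^ 2 / 4) ^ a) \<longlonglongrightarrow> 0"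
proof (rule tendsto_sandwich[OF _ _ tendsto_const])
  show "(\<lambda>n. 2 * (exp 3 / ln (real n))) \<longlonglongrightarrow> 0" by real_asymp
  show "eventually (\<lambda>n. 0 \<le> (\<Sum>a=1..m n. (exp 3 * real n * real a * p n ^ 2 / 4) ^ a)) sequentially"
    by (intro always_eventually allI sum_nonneg zero_le_power) simp
  have ev: "eventually (\<lambda>n. 0 < real n \<and> 1 \<le> ln (real n) \<and> exp 3 / ln (real n) \<le> 1 / 2) sequentially"
    by (intro eventually_conj) real_asymp+
  show "eventually (\<lambda>n. (\<Sum>a=1..m n. (exp 3 * real n * real a * p n ^ 2 / 4) ^ a) \<le> 2 * (exp 3 / ln (real n))) sequentially"
    using ev p m
  proof eventually_elim
    case (elim n)
    let ?l = "ln (real n)"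
    show ?case
    proof (rule sum_powers_le)
      fix a assume "a \<in> {1..m n}"
      then have "real a \<le> real n / ?l ^ 3" using elim by (smt (verit) atLeastAtMost_iff of_nat_le_iff)
      moreover have "(real n * p n) ^ 2 \<le> (2 * ?l) ^ 2" using elim by (intro power_mono) auto
      ultimately have "real a * (real n * p n) ^ 2 \<le> real n / ?l ^ 3 * (2 * ?l) ^ 2"
        by (intro mult_mono) (use elim in auto)
      also have "\<dots> = real n * (4 / ?l)" using elim by (simp add: field_simps power2_eq_square power3_eq_cube)
      finally have "real n * (real n * real a * p n ^ 2) \<le> real n * (4 / ?l)"
        by (simp add: power2_eq_square algebra_simps)
      then have "real n * real a * p n ^ 2 \<le> 4 / ?l" using elim by (subst (asm) mult_le_cancel_left_pos) auto
      from mult_left_mono[OF this, of "exp 3 / 4"]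
      have "exp 3 * real n * real a * p n ^ 2 / 4 \<le> exp 3 / ?l" by (simp add: mult_ac)
      then show "0 \<le> exp 3 * real n * real a * p n ^ 2 / 4 \<and> exp 3 * real n * real a * p n ^ 2 / 4 \<le> exp 3 / ?l"
        by simp
    qed (use elim in auto)
  qed
qed

text \<open>With x = (ln n)^(-4) the first factor is at most e^(2a), because a >= s >= xn, and
  dividing by the power of x contributes exp (4 (M + 2) a ln ln n). Half of the exponent a ln n / (M
  + 3) from missing edges pays for the latter; the other half is at least 3a, which leaves
  -a.\<close>

lemma not_joined_error_tendsto:
  fixes p :: "nat \<Rightarrow> real" and s :: "nat \<Rightarrow> nat" and M :: nat
  defines "x \<equiv> \<lambda>n. 1 / ln (real n) ^ 4"
  assumes p: "eventually (\<lambda>n. ln (real n) \<le> real n * p n) sequentially"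
    and s: "eventually (\<lambda>n. real n / ln (real n) ^ 4 \<le> real (s n)) sequentially"
  shows "(\<lambda>n. \<Sum>a=s n..n. exp (2 * x n * real n) / x n ^ ((M + 2) * a) * exp (- p n * real a * real n / (real M + 3))) \<longlonglongrightarrow> 0"
    (is "(\<lambda>n. \<Sum>a=s n..n. ?f n a) \<longlonglongrightarrow> 0")
proof (rule tendsto_sandwich[OF _ _ tendsto_const])
  show "(\<lambda>n. (real n + 1) * exp (- real n / ln (real n) ^ 4)) \<longlonglongrightarrow> 0" by real_asymp
  have "((\<lambda>n. ln (ln (real n)) / ln (real n)) \<longlongrightarrow> 0) sequentially" by real_asymp
  \<comment> \<open>8 = 4 * 2: the 4 is the exponent in x, the 2 comes from halving ln n / (M +
    3).\<close>
  then have ev1: "eventually (\<lambda>n. ln (ln (real n)) / ln (real n) < 1 / (8 * (real M + 2) * (real M + 3))) sequentially"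
    by (rule order_tendstoD) simp
  have "filterlim (\<lambda>n. ln (real n)) at_top sequentially" by real_asymp
  \<comment> \<open>Makes ln n / (2 (M + 3)) at least 3: 2 for the first factor and 1 to
    spare.\<close>
  then have ev2: "eventually (\<lambda>n. 6 * (real M + 3) \<le> ln (real n)) sequentially"
    by (simp add: filterlim_at_top)
  have ev: "eventually (\<lambda>n. 0 < real n \<and> 1 \<le> ln (real n)) sequentially"
    by (intro eventually_conj) real_asymp+
  show "eventually (\<lambda>n. 0 \<le> (\<Sum>a=s n..n. ?f n a)) sequentially"
    using ev by eventually_elim (auto intro!: sum_nonneg simp: x_def)
  show "eventually (\<lambda>n. (\<Sum>a=s n..n. ?f n a) \<le> (real n + 1) * exp (- real n / ln (real n) ^ 4)) sequentially"
    using ev ev1 ev2 p s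
  proof eventually_elim
    case (elim n)
    let ?l = "ln (real n)"
    have l: "0 < ?l" using elim by linarith
    have ll: "4 * (real M + 2) * ln ?l \<le> ?l / (2 * (real M + 3))"
    proof -
      have "ln ?l \<le> ?l * (1 / (8 * (real M + 2) * (real M + 3)))"
        using elim(2) l by (simp add: pos_divide_less_eq mult.commute)
      then have "4 * (real M + 2) * ln ?l \<le> 4 * (real M + 2) * (?l * (1 / (8 * (real M + 2) * (real M + 3))))"
        by (intro mult_left_mono) auto
      also have "\<dots> = ?l / (2 * (real M + 3))" by (simp add: divide_simps) (simp add: algebra_simps)
      finally show ?thesis .
    qed
    have l3: "3 \<le> ?l / (2 * (real M + 3))" using elim by (simp add: pos_le_divide_eq)
    have half: "y / c = y / (2 * c) + y / (2 * c)" for y c :: real by (cases "c = 0") (auto simp: field_simps)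
    have f: "?f n a \<le> exp (- real n / ?l ^ 4)" if a: "a \<in> {s n..n}" for a
    proof -
      have "real (s n) \<le> real a" using a by simp
      then have xa: "real n / ?l ^ 4 \<le> real a" using elim by linarith
      have "?f n a = exp (2 * x n * real n) * ?l ^ (4 * (M + 2) * a) * exp (- p n * real a * real n / (real M + 3))"
        by (simp only: x_def power_one_over power_mult[symmetric] mult.assoc divide_divide_eq_right mult_1 div_by_1)
      also have "?l ^ (4 * (M + 2) * a) = exp (real (4 * (M + 2) * a) * ln ?l)"
        using l exp_of_nat_mult[of "4 * (M + 2) * a" "ln ?l"] by simp
      also have "exp (2 * x n * real n) * \<dots> * exp (- p n * real a * real n / (real M + 3))
          = exp (2 * x n * real n + real (4 * (M + 2) * a) * ln ?l - p n * real a * real n / (real M + 3))"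
        by (simp add: exp_add[symmetric])
      also have "\<dots> \<le> exp (- real a)"
      proof -
        have 1: "2 * x n * real n \<le> real a * 2" using xa by (simp add: x_def)
        have 2: "real (4 * (M + 2) * a) * ln ?l \<le> real a * (?l / (2 * (real M + 3)))"
        proof -
          have "real (4 * (M + 2) * a) * ln ?l = real a * (4 * (real M + 2) * ln ?l)"
            by (simp add: algebra_simps)
          then show ?thesis using mult_left_mono[OF ll, of "real a"] by (simp only: of_nat_0_le_iff)
        qed
        have "real a * (?l / (real M + 3)) \<le> real a * ((real n * p n) / (real M + 3))"
          using elim by (intro mult_left_mono divide_right_mono) auto
        then have 3: "real a * (?l / (real M + 3)) \<le> p n * real a * real n / (real M + 3)"
          by (simp add: mult_ac)
        have "real a * 3 \<le> real a * (?l / (2 * (real M + 3)))" using l3 by (intro mult_left_mono) auto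
        then have "real a * 2 + real a * (?l / (2 * (real M + 3))) - real a * (?l / (real M + 3)) \<le> - real a"
          unfolding half[of ?l "real M + 3"] by (simp add: algebra_simps)
        with 1 2 3 show ?thesis by simp
      qed
      also have "\<dots> \<le> exp (- real n / ?l ^ 4)" using xa by simp
      finally show ?thesis .
    qed
    have "(\<Sum>a=s n..n. ?f n a) \<le> (\<Sum>a=s n..n. exp (- real n / ?l ^ 4))" using f by (rule sum_mono)
    also have "\<dots> = real (Suc n - s n) * exp (- real n / ?l ^ 4)" by simp
    also have "\<dots> \<le> (real n + 1) * exp (- real n / ?l ^ 4)" by (intro mult_right_mono) auto
    finally show ?case .
  qed
qed

theorem theorem5:
  fixes k :: nat
  assumes "k \<ge> 1"
  shows "(\<lambda>n. measure_pmf.prob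
            (Gnp n ((ln (real n) + (real k + 1) * ln (ln (real n)) - ln (ln (ln (real n)))) / real n))
            {E. kappa3 n E \<ge> k}) \<longlonglongrightarrow> 1"
proof -
  define p where "p n = (ln (real n) + (real k + 1) * ln (ln (real n)) - ln (ln (ln (real n)))) / real n" for n
  \<comment> \<open>The 3k connections have about 2 ln n / ln M vertices each; 480 makes their total at most ln n / 80.\<close>
  define M where "M = nat \<lceil>exp (480 * real k)\<rceil> + 2"
  define t where "t n = nat \<lfloor>ln (real n) / 40\<rfloor>" for n
  \<comment> \<open>The exponent 4 is one above the (ln n)^3 of the sparsity estimate, so a spare
    factor ln n absorbs the constant 2 (M + 3). Adding 1 ensures s >= n / (ln n)^4.\<close>
  define s where "s n = nat \<lfloor>real n / ln (real n) ^ 4\<rfloor> + 1" for n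
  \<comment> \<open>Rounding down and adding 1 makes I exceed ln n / ln M strictly, hence n < M ^
    I.\<close>
  define I where "I n = nat \<lfloor>ln (real n) / ln (real M)\<rfloor> + 1" for n
  define x where "x n = 1 / ln (real n) ^ 4" for n :: nat
  define b1 where "b1 n = real n * ((real k + 1) * (real n * p n) ^ k * exp (- p n * (real n - 1 - real k)))" for n
  define b2 where "b2 n = (real n ^ 2 * p n + real n ^ 3 * p n ^ 2) * exp (4 * real (2 * t n) - 3 / 2 * p n * (real n - 3))" for n
  define b3 where "b3 n = (\<Sum>a=1..M * s n. (exp 3 * real n * real a * p n ^ 2 / 4) ^ a)" for n
  define b4 where "b4 n = (\<Sum>a=s n..n. exp (2 * x n * real n) / x n ^ ((M + 2) * a) * exp (- p n * real a * real n / (real M + 3)))" for n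
  have M: "exp (480 * real k) \<le> real M" "2 \<le> M" unfolding M_def by linarith+
  have lnM: "480 * real k \<le> ln (real M)" using M by (simp add: ln_ge_iff)
  have lnM0: "0 < ln (real M)" using M(2) by simp
  have "filterlim (\<lambda>n. ln (real n)) at_top sequentially" by real_asymp
  then have evC: "eventually (\<lambda>n. C \<le> ln (real n)) sequentially" for C
    by (simp add: filterlim_at_top)
  \<comment> \<open>(ln n)^5 <= n gives n / (ln n)^4 >= ln n, which yields t <= s and absorbs the 1
    added in s.\<close>
  have ev: "eventually (\<lambda>n. 3 \<le> n \<and> ln (real n) ^ 5 \<le> real n \<and> 2 * ln (real n) \<le> real n) sequentially"
    by (intro eventually_conj eventually_ge_at_top) real_asymp+
  have np: "eventually (\<lambda>n. ln (real n) \<le> real n * p n \<and> real n * p n \<le> 2 * ln (real n)) sequentially"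
    using threshold_bounds[of k] ev by eventually_elim (simp add: p_def)
  have t_le: "real (t n) \<le> ln (real n) / 40" if "1 \<le> n" for n
    unfolding t_def using that by (intro of_nat_floor) simp
  have s_ge: "real n / ln (real n) ^ 4 \<le> real (s n)" for n unfolding s_def by linarith
  have s_le: "real (s n) \<le> real n / ln (real n) ^ 4 + 1" for n
    unfolding s_def by (simp add: of_nat_floor)
  have Ms: "eventually (\<lambda>n. real (M * s n) \<le> real n / ln (real n) ^ 3 \<and> (M + 3) * s n \<le> n \<and> t n \<le> s n) sequentially"
    using ev evC[of "2 * (real M + 3)"]
  proof eventually_elim
    case (elim n)
    let ?l = "ln (real n)"
    have "1 \<le> 2 * (real M + 3)" by simp
    then have l: "1 \<le> ?l" using elim(2) by (rule order_trans)
    have "?l ^ 4 \<le> ?l ^ 5" using l by (intro power_increasing) auto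
    then have "?l ^ 4 \<le> real n" using elim(1) by (meson order_trans)
    then have "1 \<le> real n / ?l ^ 4" using l by (simp add: pos_le_divide_eq)
    then have s2: "real (s n) \<le> 2 * (real n / ?l ^ 4)" using s_le[of n] by linarith
    have "(real M + 3) * real (s n) \<le> (real M + 3) * (2 * (real n / ?l ^ 4))"
      using s2 by (intro mult_left_mono) auto
    also have "\<dots> = 2 * (real M + 3) * (real n / ?l ^ 4)" by simp
    also have "\<dots> \<le> ?l * (real n / ?l ^ 4)" using elim by (intro mult_right_mono) auto
    also have "\<dots> = real n / ?l ^ 3" using l by (simp add: field_simps power_numeral_reduce)
    finally have A: "(real M + 3) * real (s n) \<le> real n / ?l ^ 3" .
    moreover have "real (M * s n) \<le> (real M + 3) * real (s n)" by (simp add: algebra_simps)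
    moreover have "real n / ?l ^ 3 \<le> real n"
    proof -
      have "1 \<le> ?l ^ 3" using l by simp
      then show ?thesis using divide_left_mono[of 1 "?l ^ 3" "real n"] l by simp
    qed
    moreover have "(M + 3) * s n \<le> n \<longleftrightarrow> (real M + 3) * real (s n) \<le> real n"
      by (metis of_nat_add of_nat_le_iff of_nat_mult of_nat_numeral)
    moreover have "t n \<le> s n"
    proof -
      have "?l * ?l ^ 4 \<le> real n" using elim by (simp add: power_numeral_reduce)
      then have "?l \<le> real n / ?l ^ 4" using l by (simp add: pos_le_divide_eq)
      then show ?thesis using t_le[of n] s_ge[of n] l elim by simp
    qed
    ultimately show ?case by linarith
  qed
  have lim: "(\<lambda>n. 1 - (b1 n + b2 n + b3 n + b4 n)) \<longlonglongrightarrow> 1 - (0 + 0 + 0 + 0)"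
  proof (intro tendsto_intros)
    show "b1 \<longlonglongrightarrow> 0" unfolding b1_def p_def by (rule min_degree_error_tendsto)
    have "eventually (\<lambda>n. real (t n) \<le> ln (real n) / 40) sequentially"
      using eventually_ge_at_top[of 1] by (rule eventually_mono) (rule t_le)
    then show "b2 \<longlonglongrightarrow> 0" unfolding b2_def by (rule low_close_error_tendsto[OF np])
    show "b3 \<longlonglongrightarrow> 0" unfolding b3_def
      by (rule dense_set_error_tendsto[OF np]) (rule eventually_mono[OF Ms], blast)
    show "b4 \<longlonglongrightarrow> 0" unfolding b4_def x_def
      by (rule not_joined_error_tendsto) (use np s_ge in \<open>auto elim: eventually_mono\<close>)
  qed
  have lower: "eventually (\<lambda>n. 1 - (b1 n + b2 n + b3 n + b4 n) \<le> measure_pmf.prob (Gnp n (p n)) {E. k \<le> kappa3 n E}) sequentially"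
    \<comment> \<open>Since t > ln n / 40 - 1, the first summand gives 4M + 1 <= t. The second lets
      ln n / 80 cover 1 + 3 + 15k; the other ln n / 80 pays for 6k ln n / ln M, the main part of the
      connections.\<close>
    using ev np Ms evC[of "40 * (4 * real M + 2) + 80 * (4 + 15 * real k)"]
  proof eventually_elim
    case (elim n)
    let ?l = "ln (real n)"
    have "1 \<le> 40 * (4 * real M + 2) + 80 * (4 + 15 * real k)" by simp
    then have l: "1 \<le> ?l" using elim(4) by (rule order_trans)
    have n0: "0 < real n" using elim by simp
    have "0 \<le> real n * p n" using elim l by linarith
    then have p0: "0 \<le> p n" using n0 by (simp add: zero_le_mult_iff)
    have "real n * p n \<le> real n * 1" using elim by linarith
    then have p1: "p n \<le> 1" using n0 by simp
    have t_ge: "?l / 40 - 1 < real (t n)" unfolding t_def by linarith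
    show ?case unfolding b1_def b2_def b3_def b4_def
    proof (rule prob_kappa3_ge[where I = "I n"])
      show "1 \<le> real n * p n" using elim l by linarith
      show "0 < x n" "x n \<le> 1" using l by (auto simp: x_def)
      show "1 < M" using M by simp
      show "4 * M + 1 \<le> t n"
      proof -
        have "4 * real M + 1 \<le> real (t n)" using t_ge elim by (simp add: field_simps)
        then show ?thesis by linarith
      qed
      show "n < M ^ I n"
      proof -
        have "?l / ln (real M) < real (I n)" unfolding I_def by linarith
        then have "?l < real (I n) * ln (real M)" using lnM0 by (simp add: pos_divide_less_eq)
        also have "\<dots> = ln (real M ^ I n)" using M by (simp add: ln_realpow)
        finally have "real n < real M ^ I n" using n0 M by (subst (asm) ln_less_cancel_iff) auto
        then show ?thesis by (simp flip: of_nat_power)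
      qed
      show "3 + 3 * k + 3 * k * (2 * I n + 2) \<le> t n"
      proof -
        have I: "real (I n) \<le> ?l / ln (real M) + 1"
          unfolding I_def using l lnM0 by (simp add: of_nat_floor)
        define q where "q = real k * (?l / ln (real M))"
        have "480 * real k * (?l / ln (real M)) \<le> ln (real M) * (?l / ln (real M))"
          using lnM l lnM0 by (intro mult_right_mono) auto
        then have kl: "480 * q \<le> ?l" using lnM0 by (simp add: q_def mult.assoc)
        have "real k * real (I n) \<le> real k * (?l / ln (real M) + 1)" using I by (intro mult_left_mono) auto
        also have "\<dots> = q + real k" by (simp add: q_def distrib_left)
        finally have "real k * real (I n) \<le> ?l / 480 + real k" using kl by linarith
        then have "3 + 3 * real k + 6 * (real k * real (I n)) + 6 * real k \<le> real (t n)"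
          using t_ge elim by (simp add: field_simps)
        then have "real (3 + 3 * k + 3 * k * (2 * I n + 2)) \<le> real (t n)" by (simp add: algebra_simps)
        then show ?thesis by (simp only: of_nat_le_iff)
      qed
    qed (use elim p0 p1 assms in auto)
  qed
  have "(\<lambda>n. measure_pmf.prob (Gnp n (p n)) {E. k \<le> kappa3 n E}) \<longlonglongrightarrow> 1"
    by (rule tendsto_sandwich[OF lower _ _ tendsto_const]) (use lim in simp_all)
  then show ?thesis by (simp add: p_def)
qed

end
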